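(* Let $(a_n)_{n\ge0}$ be Stern's sequence, defined by $a_0=0$, $a_1=1$, $a_{2n}=a_n$, $a_{2n+1}=a_n+a_{n+1}$ for $n\ge1$, and let $(b_n)_{n\ge0}$ be its twisted version, defined by $b_0=0$, $b_1=1$, $b_{2n}=-b_n$, $b_{2n+1}=-(b_n+b_{n+1})$ for $n\ge1$. Put $S(z)=\sum_{n\ge0}a_{n+1}z^n$ and $T(z)=\sum_{n\ge0}b_{n+1}z^n$. Then for all integers $b\ge2$, both $S(1/b)$ and $T(1/b)$ are transcendental and their irrationality exponents are equal to $2$.
   Context: The irrationality exponent $\mu(\xi)$ of an irrational real number $\xi$ is the supremum of the real numbers $\mu$ such that $|\xi-p/q|<q^{-\mu}$ has infinitely many solutions in rational numbers $p/q$. *)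

theory Defs
  imports "HOL-Analysis.Analysis" "HOL-Computational_Algebra.Polynomial"
begin

function stern :: "nat \<Rightarrow> int" where
  "stern n = (if n = 0 then 0 else if n = 1 then 1
              else if even n then stern (n div 2)
              else stern (n div 2) + stern (n div 2 + 1))"
  by pat_completeness auto
termination
  by (relation "Wellfounded.measure id") (auto, presburger)

function twisted_stern :: "nat \<Rightarrow> int" where
  "twisted_stern n = (if n = 0 then 0 else if n = 1 then 1
              else if even n then - twisted_stern (n div 2)
              else - (twisted_stern (n div 2) + twisted_stern (n div 2 + 1)))"
  by pat_completeness auto
termination
  by (relation "Wellfounded.measure id") (auto, presburger)

definition stern_S :: "real \<Rightarrow> real" where
  "stern_S z = (\<Sum>n. real_of_int (stern (n + 1)) * z ^ n)"

definition stern_T :: "real \<Rightarrow> real" where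
  "stern_T z = (\<Sum>n. real_of_int (twisted_stern (n + 1)) * z ^ n)"

definition irrationality_exponent :: "real \<Rightarrow> ereal" where
  "irrationality_exponent \<xi> =
     Sup (ereal ` {\<mu>::real. infinite {(p :: int, q :: int). q > 0 \<and> coprime p q \<and>
                     \<bar>\<xi> - real_of_int p / real_of_int q\<bar> < real_of_int q powr (- \<mu>)}})"

end

theory Submission
  imports Defs "Jordan_Normal_Form.Determinant" "HOL-Library.Z2" "HOL-Computational_Algebra.Computational_Algebra"
begin

text \<open>Both series satisfy $F(z) = 2t + (1 - 2t)(1 + z + z^2)F(z^2)$, with $t = 0$ for $S$ and $t = 1$ for $T$.
  Modulo 2 such an $F$ equals $1/(1 + z + z^2)$, and modulo 4 it is $(1 + 2V)/(1 + z + z^2)$ with $V$ a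
  quadratic Artin--Schreier series over the field with two elements. As $V$ is badly approximable, so is
  $F$: every $qF - p$ with $p, q$ integer polynomials of degree at most $n$, not both zero, has order at
  most $2n + 6$ at 0. Specialising Pade approximants of all degrees $n$ between $N$ and $2N$ along
  $z = b^{-2^k}$ and transporting them to $z = 1/b$ by the functional equation gives a sequence of
  rational approximations so dense and so sharp that the irrationality exponent is 2. Transcendence
  follows by Mahler's method from the transcendence of $F$ over the rational functions.\<close>

section \<open>Linear algebra over the integers and Liouville's inequality\<close>

text \<open>Modulo 2 alone the series is rational, hence too well approximable to give a bound; the
  usable information sits in the next binary digit, which is why the argument works modulo 4. The
  order of a Pade remainder lies between 2n + 1 and 2n + 6, a gap independent of n, so it costs a
  bounded power of the scale X = b^(2^k); against denominators of size X^N this loss becomes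
  negligible as N grows. The obstacle is that each use of the functional equation squares X, so a
  single approximant yields denominators too sparse for exponent 2; the degrees between N and 2N
  fill the interval from X^N to X^(2N). Algebraic irrationals have exponent 2 as well, so
  transcendence needs its own argument. There the two signs separate: h(z) = (1 + z + z^2) h(z^2) is
  solved by S itself, whereas h(z) = -(1 + z + z^2) h(z^2) has no non-zero Laurent series solution,
  because its lowest coefficient would equal its own negative.\<close>

lemma nontrivial_int_solution:
  fixes A :: "nat \<Rightarrow> nat \<Rightarrow> int"
  assumes "m < n"
  obtains x :: "nat \<Rightarrow> int" where "\<exists>j<n. x j \<noteq> 0" "\<And>i. i < m \<Longrightarrow> (\<Sum>j<n. A i j * x j) = 0"
proof -
  \<comment> \<open>Padding the m equations with zero rows gives a square matrix whose row m is
    zero, so every Leibniz product vanishes. The kernel vector is found over the integers directly,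
    with no denominators to clear.\<close>
  define B where "B = mat n n (\<lambda>(i, j). if i < m then A i j else 0)"
  have B: "B \<in> carrier_mat n n" by (simp add: B_def)
  have "Determinant.det B = (\<Sum>p\<in>{p. p permutes {0..<n}}. signof p * (\<Prod>i = 0..<n. B $$ (i, p i)))"
    by (rule det_def'[OF B])
  also have "\<dots> = 0"
  proof (rule sum.neutral, safe)
    fix p assume p: "p permutes {0..<n}"
    have "p m < n" using p assms by (metis atLeastLessThan_iff permutes_in_image zero_le)
    hence "B $$ (m, p m) = 0" using assms by (simp add: B_def)
    hence "(\<Prod>i = 0..<n. B $$ (i, p i)) = 0" using assms by (intro prod_zero) auto
    thus "signof p * (\<Prod>i = 0..<n. B $$ (i, p i)) = 0" by simp
  qed
  finally obtain v where v: "v \<in> carrier_vec n" "v \<noteq> 0\<^sub>v n" "B *\<^sub>v v = 0\<^sub>v n"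
    using det_0_iff_vec_prod_zero[OF B] by blast
  show thesis
  proof
    show "\<exists>j<n. vec_index v j \<noteq> 0" using v(1,2) by (auto simp: vec_eq_iff)
    fix i assume i: "i < m"
    have "vec_index (B *\<^sub>v v) i = (\<Sum>j<n. A i j * vec_index v j)"
      using i assms v(1) by (auto simp: B_def scalar_prod_def lessThan_atLeast0 intro!: sum.cong)
    thus "(\<Sum>j<n. A i j * vec_index v j) = 0" using v(3) i assms by simp
  qed
qed

lemma abs_det_le:
  fixes M :: "int mat"
  assumes M: "M \<in> carrier_mat n n" and B: "\<And>i j. i < n \<Longrightarrow> j < n \<Longrightarrow> \<bar>M $$ (i, j)\<bar> \<le> B"
  shows "\<bar>Determinant.det M\<bar> \<le> fact n * B ^ n"
proof -
  have "\<bar>Determinant.det M\<bar> \<le> (\<Sum>p\<in>{p. p permutes {0..<n}}. \<bar>signof p * (\<Prod>i = 0..<n. M $$ (i, p i))\<bar>)"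
    unfolding det_def'[OF M] by (rule sum_abs)
  also have "\<dots> \<le> (\<Sum>p\<in>{p. p permutes {0..<n}}. B ^ n)"
  proof (rule sum_mono, safe)
    fix p assume p: "p permutes {0..<n}"
    have pn: "p i < n" if "i < n" for i
      using p that by (metis atLeastLessThan_iff permutes_in_image zero_le)
    have "\<bar>signof p * (\<Prod>i = 0..<n. M $$ (i, p i))\<bar> = (\<Prod>i = 0..<n. \<bar>M $$ (i, p i)\<bar>)"
      by (simp add: abs_mult abs_prod sign_def)
    also have "\<dots> \<le> (\<Prod>i = 0..<n. B)" using B pn by (intro prod_mono) auto
    finally show "\<bar>signof p * (\<Prod>i = 0..<n. M $$ (i, p i))\<bar> \<le> B ^ n" by simp
  qed
  also have "\<dots> = fact n * B ^ n" by (simp add: card_permutations)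
  finally show ?thesis .
qed

lemma sum_mult_sum_swap:
  fixes m :: "'a \<Rightarrow> 'b \<Rightarrow> 'c::comm_semiring_0"
  shows "(\<Sum>i\<in>I. u i * (\<Sum>j\<in>J. m i j * t j)) = (\<Sum>j\<in>J. (\<Sum>i\<in>I. m i j * u i) * t j)"
proof -
  have "(\<Sum>i\<in>I. u i * (\<Sum>j\<in>J. m i j * t j)) = (\<Sum>i\<in>I. \<Sum>j\<in>J. m i j * u i * t j)"
    by (simp add: sum_distrib_left mult_ac)
  also have "\<dots> = (\<Sum>j\<in>J. \<Sum>i\<in>I. m i j * u i * t j)" by (rule sum.swap)
  finally show ?thesis by (simp add: sum_distrib_right)
qed

text \<open>Abstracting over \<open>h\<close> lets one argument serve both integer relations of a
  real number (\<open>of_int\<close>) and polynomial relations of a power series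
  (\<open>fps_of_poly\<close>). Minimality is taken over relations with non-zero top coefficient,
  which makes the lower powers independent.\<close>

lemma minimal_relation:
  fixes h :: "'a::zero \<Rightarrow> 'b::comm_ring_1" and c :: "nat \<Rightarrow> 'a"
  assumes h: "\<And>a. h a = 0 \<longleftrightarrow> a = 0"
    and c: "m \<le> n" "c m \<noteq> 0" "(\<Sum>i\<le>n. h (c i) * \<theta> ^ i) = 0"
  obtains d c' where "d > 0" "c' d \<noteq> 0" "(\<Sum>i\<le>d. h (c' i) * \<theta> ^ i) = 0"
    "\<And>w i. (\<Sum>i<d. h (w i) * \<theta> ^ i) = 0 \<Longrightarrow> i < d \<Longrightarrow> w i = 0"
proof -
  define R where "R d \<longleftrightarrow> (\<exists>c. c d \<noteq> 0 \<and> (\<Sum>i\<le>d. h (c i) * \<theta> ^ i) = 0)" for d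
  \<comment> \<open>Top coefficients of a given relation may vanish; cutting it at the last non-zero
    one brings it into the form \<open>R\<close>.\<close>
  have top: "\<exists>e. m \<le> e \<and> e \<le> n \<and> R e" if "m \<le> n" "w m \<noteq> 0" "(\<Sum>i\<le>n. h (w i) * \<theta> ^ i) = 0" for w m n
  proof -
    define e where "e = Max {i. i \<le> n \<and> w i \<noteq> 0}"
    have "e \<in> {i. i \<le> n \<and> w i \<noteq> 0}" unfolding e_def using that by (intro Max_in) auto
    moreover have "m \<le> e" unfolding e_def using that by (intro Max_ge) auto
    ultimately have e: "e \<le> n" "w e \<noteq> 0" "m \<le> e" by auto
    have "w i = 0" if "i \<le> n" "i > e" for i
      using that Max_ge[of "{i. i \<le> n \<and> w i \<noteq> 0}" i] unfolding e_def by fastforce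
    hence "(\<Sum>i\<le>n. h (w i) * \<theta> ^ i) = (\<Sum>i\<le>e. h (w i) * \<theta> ^ i)"
      using e iffD2[OF h refl] by (intro sum.mono_neutral_right) (auto simp: not_le)
    thus ?thesis using that(3) e unfolding R_def by metis
  qed
  define d where "d = (LEAST d. R d)"
  have Rd: "R d" unfolding d_def using top[OF c] by (blast intro: LeastI[of R])
  then obtain c' where c': "c' d \<noteq> 0" "(\<Sum>i\<le>d. h (c' i) * \<theta> ^ i) = 0" unfolding R_def by blast
  have "d > 0" using c' h by (cases d) auto
  moreover have "w i = 0" if w: "(\<Sum>i<d. h (w i) * \<theta> ^ i) = 0" "i < d" for w i
  proof (rule ccontr)
    assume "w i \<noteq> 0"
    moreover have "{..<d} = {..d - 1}" using \<open>d > 0\<close> by auto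
    ultimately obtain e where "e \<le> d - 1" "R e" using top[of i "d - 1" w] w by auto
    thus False using \<open>d > 0\<close> not_less_Least[of e R] unfolding d_def by linarith
  qed
  ultimately show thesis using that c' by blast
qed

lemma algebraic_int_relation:
  fixes \<theta> :: real
  assumes "algebraic \<theta>"
  obtains n and c :: "nat \<Rightarrow> int" where "c n \<noteq> 0" "(\<Sum>i\<le>n. of_int (c i) * \<theta> ^ i) = 0"
proof -
  obtain p where p: "\<And>i. coeff p i \<in> \<int>" "p \<noteq> 0" "poly p \<theta> = 0" using assms unfolding algebraic_def by blast
  from p(1) have "\<exists>k::int. coeff p i = of_int k" for i by (rule Ints_cases) blast
  then obtain c :: "nat \<Rightarrow> int" where c: "\<And>i. coeff p i = of_int (c i)" by metis
  show thesis
  proof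
    show "c (degree p) \<noteq> 0" using c[of "degree p"] p(2) by (metis leading_coeff_0_iff of_int_0)
    show "(\<Sum>i\<le>degree p. of_int (c i) * \<theta> ^ i) = 0" using p(3) by (simp add: c poly_altdef)
  qed
qed

text \<open>Multiplication by the value y of the sum, scaled by a power of the leading coefficient,
  is an integer matrix on the basis 1, ..., \<open>\<theta> ^ (d - 1)\<close>. Its determinant is a
  non-zero integer and equals y times a combination of cofactors, each a determinant of size d - 1
  with entries O(H). The exponent d - 1 is independent of N, so N may be chosen afterwards in terms
  of d.\<close>

lemma liouville_polynomial:
  fixes \<theta> :: real
  assumes "algebraic \<theta>"
  obtains d :: nat where "d > 0"
    "\<And>N. \<exists>c>0. \<forall>H g. H \<ge> 1 \<longrightarrow> (\<forall>i\<le>N. \<bar>real_of_int (g i)\<bar> \<le> H) \<longrightarrow> (\<Sum>i\<le>N. of_int (g i) * \<theta> ^ i) \<noteq> 0 \<longrightarrow>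
        c \<le> \<bar>\<Sum>i\<le>N. of_int (g i) * \<theta> ^ i\<bar> * H ^ (d - 1)"
proof -
  obtain n and c0 :: "nat \<Rightarrow> int" where c0: "c0 n \<noteq> 0" "(\<Sum>i\<le>n. of_int (c0 i) * \<theta> ^ i) = 0"
    using algebraic_int_relation[OF assms] by metis
  obtain d and c :: "nat \<Rightarrow> int" where d: "d > 0" and cd: "c d \<noteq> 0"
    and rel: "(\<Sum>i\<le>d. of_int (c i) * \<theta> ^ i) = 0"
    and indep: "\<And>w i. (\<Sum>i<d. of_int (w i) * \<theta> ^ i) = 0 \<Longrightarrow> i < d \<Longrightarrow> w i = (0::int)"
    by (rule minimal_relation[of "of_int :: int \<Rightarrow> real" n n c0 \<theta>]) (use c0 in auto)
  \<comment> \<open>The minimal relation puts \<open>c d * \<theta> ^ d\<close> in the integer span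
    of the lower powers, so every power of \<open>c d * \<theta>\<close> stays in that span.\<close>
  have "\<exists>r::nat \<Rightarrow> int. (of_int (c d) * \<theta>) ^ e = (\<Sum>j<d. of_int (r j) * \<theta> ^ j)" for e
  proof (induction e)
    case 0
    show ?case using d by (intro exI[of _ "\<lambda>j. if j = 0 then 1 else 0"]) (simp add: if_distrib if_distribR sum.delta cong: if_cong)
  next
    case (Suc e)
    then obtain r :: "nat \<Rightarrow> int" where r: "(of_int (c d) * \<theta>) ^ e = (\<Sum>j<d. of_int (r j) * \<theta> ^ j)" by blast
    obtain d' where d': "d = Suc d'" using d by (cases d) auto
    have top: "of_int (c d) * \<theta> ^ d = - (\<Sum>j<d. of_int (c j) * \<theta> ^ j)"
      using rel by (simp add: lessThan_Suc_atMost[symmetric])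
    have "(of_int (c d) * \<theta>) ^ Suc e = of_int (c d) * \<theta> * (\<Sum>j<d. of_int (r j) * \<theta> ^ j)"
      using r by simp
    also have "\<dots> = (\<Sum>j<d'. of_int (c d * r j) * \<theta> ^ Suc j) + of_int (r d') * (of_int (c d) * \<theta> ^ d)"
      by (simp add: d' sum_distrib_left algebra_simps)
    also have "(\<Sum>j<d'. of_int (c d * r j) * \<theta> ^ Suc j) = (\<Sum>j<d. of_int (if j = 0 then 0 else c d * r (j - 1)) * \<theta> ^ j)"
      unfolding d' by (subst sum.lessThan_Suc_shift) simp
    also have "\<dots> + of_int (r d') * (of_int (c d) * \<theta> ^ d) =
        (\<Sum>j<d. of_int ((if j = 0 then 0 else c d * r (j - 1)) - r d' * c j) * \<theta> ^ j)"
      unfolding top by (simp add: sum_distrib_left sum_subtractf algebra_simps)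
    finally show ?case by (intro exI[of _ "\<lambda>j. (if j = 0 then 0 else c d * r (j - 1)) - r d' * c j"])
  qed
  then obtain r :: "nat \<Rightarrow> nat \<Rightarrow> int" where
    r: "\<And>e. (of_int (c d) * \<theta>) ^ e = (\<Sum>j<d. of_int (r e j) * \<theta> ^ j)" by metis
  show thesis
  proof (rule that[OF d])
    fix N
    define K where "K = \<bar>c d\<bar> ^ (N + d) * (\<Sum>e\<le>N + d. \<Sum>j<d. \<bar>r e j\<bar>) * (int N + 1) + 1"
    have "(\<Sum>e\<le>N + d. \<Sum>j<d. \<bar>r e j\<bar>) \<ge> 0" by (intro sum_nonneg) auto
    hence K1: "K \<ge> 1" by (simp add: K_def)
    define L where "L = real d * (fact (d - 1) * of_int K ^ (d - 1)) * (\<bar>\<theta>\<bar> + 1) ^ d * \<bar>of_int (c d)\<bar> ^ (N + d)"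
    have L: "L > 0" using d K1 cd by (auto simp: L_def intro!: mult_pos_pos zero_less_power)
    have rK: "\<bar>r e j\<bar> \<le> (\<Sum>e\<le>N + d. \<Sum>j<d. \<bar>r e j\<bar>)" if "e \<le> N + d" "j < d" for e j
    proof -
      have "\<bar>r e j\<bar> \<le> (\<Sum>j<d. \<bar>r e j\<bar>)" using that by (intro member_le_sum) auto
      also have "\<dots> \<le> (\<Sum>e\<le>N + d. \<Sum>j<d. \<bar>r e j\<bar>)" using that
        by (intro member_le_sum[of e _ "\<lambda>e. \<Sum>j<d. \<bar>r e j\<bar>"]) (auto intro: sum_nonneg)
      finally show ?thesis .
    qed
    show "\<exists>c>0. \<forall>H g. H \<ge> 1 \<longrightarrow> (\<forall>i\<le>N. \<bar>real_of_int (g i)\<bar> \<le> H) \<longrightarrow> (\<Sum>i\<le>N. of_int (g i) * \<theta> ^ i) \<noteq> 0 \<longrightarrow>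
        c \<le> \<bar>\<Sum>i\<le>N. of_int (g i) * \<theta> ^ i\<bar> * H ^ (d - 1)"
    proof (intro exI[of _ "1 / L"] conjI allI impI)
      show "1 / L > 0" using L by simp
      fix H :: real and g :: "nat \<Rightarrow> int"
      assume H1: "H \<ge> 1" and H: "\<forall>i\<le>N. \<bar>real_of_int (g i)\<bar> \<le> H"
      define y where "y = (\<Sum>i\<le>N. of_int (g i) * \<theta> ^ i)"
      assume "(\<Sum>i\<le>N. of_int (g i) * \<theta> ^ i) \<noteq> 0"
      hence y0: "y \<noteq> 0" by (simp add: y_def)
      \<comment> \<open>The coefficients are integers, so their bound may be rounded down; this
        keeps the determinant estimate over the integers.\<close>
      define h where "h = nat \<lfloor>H\<rfloor>"
      have hH: "real h \<le> H" "h \<ge> 1" using H1 by (auto simp: h_def le_nat_floor)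
      have gh: "\<bar>g i\<bar> \<le> int h" if "i \<le> N" for i
        using H that H1 unfolding h_def by (auto simp: le_floor_iff)
      \<comment> \<open>Row i expresses \<open>c d ^ (N + d) * y * \<theta> ^ i\<close> in the
        basis. The exponent \<open>N + d - i - e\<close> is a true difference since i < d and e
        \<le> N.\<close>
      define M where "M = mat d d (\<lambda>(i, j). \<Sum>e\<le>N. g e * c d ^ (N + d - i - e) * r (i + e) j)"
      have M: "M \<in> carrier_mat d d" by (simp add: M_def)
      have Mv: "(\<Sum>j<d. of_int (M $$ (i, j)) * \<theta> ^ j) = of_int (c d) ^ (N + d) * y * \<theta> ^ i" if i: "i < d" for i
      proof -
        have "(\<Sum>j<d. of_int (M $$ (i, j)) * \<theta> ^ j)
            = (\<Sum>j<d. \<Sum>e\<le>N. of_int (g e) * of_int (c d) ^ (N + d - i - e) * (of_int (r (i + e) j) * \<theta> ^ j))"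
          using i by (simp add: M_def sum_distrib_right mult.assoc)
        also have "\<dots> = (\<Sum>e\<le>N. of_int (g e) * of_int (c d) ^ (N + d - i - e) * (of_int (c d) * \<theta>) ^ (i + e))"
          by (subst sum.swap) (simp add: r sum_distrib_left)
        also have "\<dots> = (\<Sum>e\<le>N. of_int (c d) ^ (N + d) * \<theta> ^ i * (of_int (g e) * \<theta> ^ e))"
        proof (rule sum.cong)
          fix e assume "e \<in> {..N}"
          hence "N + d = (N + d - i - e) + (i + e)" using i by auto
          hence "(of_int (c d) :: real) ^ (N + d) = of_int (c d) ^ (N + d - i - e) * of_int (c d) ^ (i + e)"
            by (metis power_add)
          thus "of_int (g e) * of_int (c d) ^ (N + d - i - e) * (of_int (c d) * \<theta>) ^ (i + e) =
              of_int (c d) ^ (N + d) * \<theta> ^ i * (of_int (g e) * \<theta> ^ e)"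
            by (simp add: power_mult_distrib power_add)
        qed simp
        also have "\<dots> = of_int (c d) ^ (N + d) * y * \<theta> ^ i"
          by (simp add: y_def sum_distrib_left algebra_simps)
        finally show ?thesis .
      qed
      have Mb: "\<bar>M $$ (i, j)\<bar> \<le> K * int h" if ij: "i < d" "j < d" for i j
      proof -
        have "\<bar>M $$ (i, j)\<bar> \<le> (\<Sum>e\<le>N. \<bar>g e * c d ^ (N + d - i - e) * r (i + e) j\<bar>)"
          using ij by (auto simp: M_def)
        also have "\<dots> \<le> (\<Sum>e\<le>N. int h * \<bar>c d\<bar> ^ (N + d) * (\<Sum>e\<le>N + d. \<Sum>j<d. \<bar>r e j\<bar>))"
        proof (rule sum_mono)
          fix e assume e: "e \<in> {..N}"
          have "\<bar>c d\<bar> ^ (N + d - i - e) \<le> \<bar>c d\<bar> ^ (N + d)" using cd by (intro power_increasing) auto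
          thus "\<bar>g e * c d ^ (N + d - i - e) * r (i + e) j\<bar> \<le> int h * \<bar>c d\<bar> ^ (N + d) * (\<Sum>e\<le>N + d. \<Sum>j<d. \<bar>r e j\<bar>)"
            unfolding abs_mult power_abs using gh[of e] e ij by (intro mult_mono rK) auto
        qed
        also have "\<dots> \<le> K * int h" by (simp add: K_def algebra_simps)
        finally show ?thesis .
      qed
      have det0: "Determinant.det M \<noteq> 0"
      proof
        assume "Determinant.det M = 0"
        hence "Determinant.det (transpose_mat M) = 0" using M by (simp add: Determinant.det_transpose)
        then obtain v where v: "v \<in> carrier_vec d" "v \<noteq> 0\<^sub>v d" "transpose_mat M *\<^sub>v v = 0\<^sub>v d"
          using det_0_iff_vec_prod_zero[of "transpose_mat M" d] M by auto
        have col: "(\<Sum>i<d. M $$ (i, j) * vec_index v i) = 0" if "j < d" for j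
        proof -
          have "vec_index (transpose_mat M *\<^sub>v v) j = (\<Sum>i<d. M $$ (i, j) * vec_index v i)"
            using that M v(1) by (auto simp: scalar_prod_def lessThan_atLeast0 intro!: sum.cong)
          thus ?thesis using v(3) that by simp
        qed
        have "of_int (c d) ^ (N + d) * y * (\<Sum>i<d. of_int (vec_index v i) * \<theta> ^ i)
            = (\<Sum>i<d. of_int (vec_index v i) * (of_int (c d) ^ (N + d) * y * \<theta> ^ i))"
          by (simp add: sum_distrib_left mult_ac)
        also have "\<dots> = (\<Sum>i<d. of_int (vec_index v i) * (\<Sum>j<d. of_int (M $$ (i, j)) * \<theta> ^ j))"
          by (simp add: Mv)
        also have "\<dots> = (\<Sum>j<d. of_int (\<Sum>i<d. M $$ (i, j) * vec_index v i) * \<theta> ^ j)"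
          by (simp add: sum_mult_sum_swap)
        also have "\<dots> = 0" using col by simp
        finally have "(\<Sum>i<d. of_int (vec_index v i) * \<theta> ^ i) = 0" using y0 cd by simp
        from indep[OF this] have "v = 0\<^sub>v d" using v(1) by auto
        thus False using v(2) by simp
      qed
      \<comment> \<open>Row 0 of the adjugate turns M into \<open>det M\<close> times the first unit
        vector. The basis element with index 0 is 1, so pairing with the powers of
        \<open>\<theta>\<close> returns the determinant itself.\<close>
      define a where "a j = adj_mat M $$ (0, j)" for j
      have adj: "(\<Sum>i<d. a i * M $$ (i, j)) = (if j = 0 then Determinant.det M else 0)" if "j < d" for j
      proof -
        have "(adj_mat M * M) $$ (0, j) = (\<Sum>i<d. a i * M $$ (i, j))"
          using that d M adj_mat(1)[OF M] by (auto simp: scalar_prod_def lessThan_atLeast0 a_def intro!: sum.cong)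
        thus ?thesis using adj_mat(3)[OF M] that d by (cases "j = 0") auto
      qed
      have ab: "\<bar>a j\<bar> \<le> fact (d - 1) * (K * int h) ^ (d - 1)" if j: "j < d" for j
      proof -
        have md: "mat_delete M j 0 \<in> carrier_mat (d - 1) (d - 1)" using M by (rule mat_delete_carrier)
        have "a j = cofactor M j 0" using j d M by (simp add: a_def adj_mat_def)
        hence "\<bar>a j\<bar> = \<bar>Determinant.det (mat_delete M j 0)\<bar>" by (simp add: cofactor_def abs_mult)
        also have "\<dots> \<le> fact (d - 1) * (K * int h) ^ (d - 1)"
          using M j by (intro abs_det_le[OF md]) (auto simp: mat_delete_def intro!: Mb)
        finally show ?thesis .
      qed
      have "real_of_int (Determinant.det M) = (\<Sum>j<d. of_int (\<Sum>i<d. a i * M $$ (i, j)) * \<theta> ^ j)"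
        using d by (simp add: adj if_distrib if_distribR cong: if_cong)
      also have "\<dots> = (\<Sum>i<d. of_int (a i) * (\<Sum>j<d. of_int (M $$ (i, j)) * \<theta> ^ j))"
        by (subst sum_mult_sum_swap) (simp add: mult.commute)
      also have "\<dots> = (\<Sum>i<d. of_int (a i) * (of_int (c d) ^ (N + d) * y * \<theta> ^ i))"
        by (simp add: Mv)
      also have "\<dots> = of_int (c d) ^ (N + d) * y * (\<Sum>i<d. of_int (a i) * \<theta> ^ i)"
        by (simp add: sum_distrib_left mult_ac)
      finally have det: "real_of_int (Determinant.det M) = of_int (c d) ^ (N + d) * y * (\<Sum>i<d. of_int (a i) * \<theta> ^ i)" .
      have "\<bar>\<Sum>i<d. of_int (a i) * \<theta> ^ i\<bar> \<le> (\<Sum>i<d. \<bar>of_int (a i) * \<theta> ^ i\<bar>)" by (rule sum_abs)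
      also have "\<dots> \<le> (\<Sum>i<d. (fact (d - 1) * (of_int K ^ (d - 1) * H ^ (d - 1))) * (\<bar>\<theta>\<bar> + 1) ^ d)"
      proof (rule sum_mono)
        fix i assume i: "i \<in> {..<d}"
        have "\<bar>real_of_int (a i)\<bar> \<le> real_of_int (fact (d - 1) * (K * int h) ^ (d - 1))"
          using ab[of i] i by (metis lessThan_iff of_int_abs of_int_le_iff)
        also have "\<dots> = fact (d - 1) * (of_int K ^ (d - 1) * real h ^ (d - 1))"
          by (simp add: power_mult_distrib)
        also have "\<dots> \<le> fact (d - 1) * (of_int K ^ (d - 1) * H ^ (d - 1))"
          using hH K1 by (intro mult_left_mono power_mono) auto
        finally have 1: "\<bar>real_of_int (a i)\<bar> \<le> fact (d - 1) * (of_int K ^ (d - 1) * H ^ (d - 1))" .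
        have "\<bar>\<theta>\<bar> ^ i \<le> (\<bar>\<theta>\<bar> + 1) ^ i" by (intro power_mono) auto
        also have "\<dots> \<le> (\<bar>\<theta>\<bar> + 1) ^ d" using i by (intro power_increasing) auto
        finally show "\<bar>of_int (a i) * \<theta> ^ i\<bar> \<le> (fact (d - 1) * (of_int K ^ (d - 1) * H ^ (d - 1))) * (\<bar>\<theta>\<bar> + 1) ^ d"
          unfolding abs_mult power_abs using 1 by (intro mult_mono) auto
      qed
      also have "\<dots> = real d * (fact (d - 1) * (of_int K ^ (d - 1) * H ^ (d - 1))) * (\<bar>\<theta>\<bar> + 1) ^ d" by simp
      finally have "\<bar>\<Sum>i<d. of_int (a i) * \<theta> ^ i\<bar> \<le> \<dots>" .
      hence "\<bar>of_int (c d)\<bar> ^ (N + d) * \<bar>y\<bar> * \<bar>\<Sum>i<d. of_int (a i) * \<theta> ^ i\<bar> \<le> \<bar>of_int (c d)\<bar> ^ (N + d) * \<bar>y\<bar> * \<dots>"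
        by (intro mult_left_mono) auto
      also have "\<dots> = L * (\<bar>y\<bar> * H ^ (d - 1))" by (simp add: L_def)
      finally have "\<bar>real_of_int (Determinant.det M)\<bar> \<le> L * (\<bar>y\<bar> * H ^ (d - 1))"
        by (simp add: det abs_mult power_abs)
      moreover have "1 \<le> \<bar>real_of_int (Determinant.det M)\<bar>" using det0 by linarith
      ultimately show "1 / L \<le> \<bar>\<Sum>i\<le>N. of_int (g i) * \<theta> ^ i\<bar> * H ^ (d - 1)"
        using L unfolding y_def[symmetric] by (simp add: field_simps)
    qed
  qed
qed

section \<open>Power series and polynomials over the field with two elements\<close>

text \<open>The target ring is left open because it is \<open>bit\<close> for reduction modulo 2 and
  \<open>real\<close> for evaluation.\<close>

definition fps_of_ints :: "int fps \<Rightarrow> 'a::comm_ring_1 fps" where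
  "fps_of_ints F = Abs_fps (\<lambda>n. of_int (fps_nth F n))"

lemma fps_of_ints_nth [simp]: "fps_nth (fps_of_ints F) n = of_int (fps_nth F n)"
  by (simp add: fps_of_ints_def)

lemma fps_of_ints_add [simp]: "fps_of_ints (F + G) = fps_of_ints F + fps_of_ints G"
  and fps_of_ints_diff [simp]: "fps_of_ints (F - G) = fps_of_ints F - fps_of_ints G"
  and fps_of_ints_mult [simp]: "fps_of_ints (F * G) = fps_of_ints F * fps_of_ints G"
  and fps_of_ints_const [simp]: "fps_of_ints (fps_const c) = fps_const (of_int c)"
  and fps_of_ints_0 [simp]: "fps_of_ints 0 = 0"
  and fps_of_ints_1 [simp]: "fps_of_ints 1 = 1"
  and fps_of_ints_X [simp]: "fps_of_ints fps_X = fps_X"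
  by (auto simp: fps_eq_iff fps_mult_nth fps_X_def)

lemma fps_of_ints_compose_X2 [simp]: "fps_of_ints (F oo fps_X\<^sup>2) = fps_of_ints F oo fps_X\<^sup>2"
  by (auto simp: fps_eq_iff fps_nth_compose_X_power)

lemma fps_of_ints_power [simp]: "fps_of_ints (F ^ n) = fps_of_ints F ^ n"
  by (induction n) auto

lemma fps_of_ints_sum [simp]: "fps_of_ints (sum f A) = (\<Sum>x\<in>A. fps_of_ints (f x))"
  by (induction A rule: infinite_finite_induct) auto

lemma fps_of_ints_numeral [simp]: "fps_of_ints (numeral k) = numeral k"
  by (simp add: numeral_fps_const)

lemma fps_of_ints_of_poly [simp]: "fps_of_ints (fps_of_poly p) = fps_of_poly (map_poly of_int p)"
  by (simp add: fps_eq_iff coeff_map_poly)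

text \<open>In characteristic 2 the terms at i and n - i cancel, and only a middle term can
  survive.\<close>

lemma bit_sum_palindrome:
  fixes g :: "nat \<Rightarrow> bit"
  assumes "\<And>i. i \<le> n \<Longrightarrow> g (n - i) = g i"
  shows "(\<Sum>i\<le>n. g i) = (if even n then g (n div 2) else 0)"
  using assms
proof (induction n arbitrary: g rule: induct_nat_012)
  case 0
  show ?case by simp
next
  case 1
  from 1[of 0] show ?case by simp
next
  case (ge2 n)
  have "g (Suc (n - i)) = g (Suc i)" if "i \<le> n" for i
    using ge2.prems[of "Suc i"] that by (simp add: Suc_diff_le)
  hence IH: "(\<Sum>i\<le>n. g (Suc i)) = (if even n then g (Suc (n div 2)) else 0)" by (rule ge2.IH(1))
  have "(\<Sum>i\<le>Suc (Suc n). g i) = g 0 + (\<Sum>i\<le>n. g (Suc i)) + g (Suc (Suc n))"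
    by (subst sum.atMost_Suc_shift) (simp only: sum.atMost_Suc add.assoc)
  also have "\<dots> = (\<Sum>i\<le>n. g (Suc i))"
    using ge2.prems[of 0] by (cases "g 0"; cases "\<Sum>i\<le>n. g (Suc i)") simp_all
  finally show ?case using IH by simp
qed

text \<open>This is the Frobenius map: modulo 2 the substitution of z^2 is squaring, which turns the
  functional equation into an algebraic one.\<close>

lemma bit_fps_square: "(F :: bit fps)\<^sup>2 = F oo fps_X\<^sup>2"
proof (rule fps_ext)
  fix n
  have "fps_nth (F\<^sup>2) n = (\<Sum>i\<le>n. fps_nth F i * fps_nth F (n - i))"
    by (simp add: power2_eq_square fps_mult_nth atMost_atLeast0)
  also have "\<dots> = (if even n then fps_nth F (n div 2) * fps_nth F (n - n div 2) else 0)"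
    by (rule bit_sum_palindrome) (simp add: mult.commute)
  also have "\<dots> = fps_nth (F oo fps_X\<^sup>2) n"
    by (auto simp: fps_nth_compose_X_power)
  finally show "fps_nth (F\<^sup>2) n = fps_nth (F oo fps_X\<^sup>2) n" .
qed

lemma bit_fps_two [simp]: "(2 :: bit fps) = 0"
  by (simp add: numeral_fps_const)

lemma of_int_bit_eq_0_iff: "(of_int k :: bit) = 0 \<longleftrightarrow> even k"
  by (cases "even k") (auto elim!: evenE oddE)

definition quad :: "'a::comm_ring_1 poly" where "quad = [:1, 1, 1:]"

lemma fps_of_poly_quad: "fps_of_poly quad = 1 + fps_X + fps_X\<^sup>2"
  by (simp add: quad_def fps_of_poly_pCons power2_eq_square algebra_simps)

lemma degree_quad [simp]: "degree (quad :: 'a::comm_ring_1 poly) = 2" and quad_nz [simp]: "(quad :: 'a poly) \<noteq> 0"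
  by (simp_all add: quad_def)

text \<open>\<open>quad\<close> is irreducible over the field with two elements; only the resulting
  divisibility for squares enters the descent below, and it is checked on remainders of degree at
  most 1.\<close>

lemma bit_poly_quad_dvd_of_square:
  fixes R :: "bit poly"
  assumes "quad dvd R\<^sup>2"
  shows "quad dvd R"
proof -
  define r where "r = R mod quad"
  have "degree r < 2" using degree_mod_less'[of quad R] by (cases "r = 0") (auto simp: r_def)
  obtain c d where r: "r = [:c, d:]"
  proof
    show "r = [:coeff r 0, coeff r 1:]"
      by (rule poly_eqI) (use \<open>degree r < 2\<close> in \<open>auto simp: coeff_pCons coeff_eq_0 split: nat.splits\<close>)
  qed
  define s where "s = R div quad"
  have "R = quad * s + r" by (simp add: r_def s_def)
  hence "R\<^sup>2 = quad * (quad * s\<^sup>2 + 2 * s * r) + r\<^sup>2"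
    by (simp add: power2_eq_square algebra_simps)
  hence "quad dvd r\<^sup>2" using assms by (metis dvd_add_right_iff dvd_triv_left)
  \<comment> \<open>Squaring c + dX gives c + dX^2, and X^2 is congruent to X + 1 modulo
    \<open>quad\<close>.\<close>
  moreover have "r\<^sup>2 = quad * [:d:] + [:c + d, d:]"
    by (cases c; cases d) (simp_all add: r quad_def power2_eq_square)
  ultimately have "quad dvd [:c + d, d:]" by (metis dvd_add_right_iff dvd_triv_left)
  moreover have "degree [:c + d, d:] < degree (quad :: bit poly)" by (simp add: degree_pCons_eq_if)
  ultimately have "[:c + d, d:] = 0" using dvd_imp_degree_le leD by blast
  hence "r = 0" by (cases c; cases d) (simp_all add: r)
  thus ?thesis by (simp add: r_def mod_eq_0_iff_dvd)
qed

text \<open>If quad (W^2 + W) = X, the form is the product of R + quad p W and its conjugate R +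
  quad p (W + 1). It is anisotropic because X / quad has a simple pole at \<open>quad\<close>: that
  polynomial divides R, then p, and dividing it out gives the same equation in smaller
  degree.\<close>

lemma bit_poly_norm_form_nonzero:
  fixes R p :: "bit poly"
  assumes "R\<^sup>2 + R * quad * p + quad * [:0, 1:] * p\<^sup>2 = 0"
  shows "p = 0"
  using assms
proof (induction "degree p" arbitrary: R p rule: less_induct)
  case less
  show ?case
  proof (rule ccontr)
    assume p0: "p \<noteq> 0"
    define X :: "bit poly" where "X = [:0, 1:]"
    note eq = less.prems[folded X_def]
    have qX: "quad = 1 + X + X\<^sup>2" by (simp add: quad_def X_def power2_eq_square one_pCons)
    have "R\<^sup>2 = (R\<^sup>2 + R * quad * p + quad * X * p\<^sup>2) + quad * (- R * p - X * p\<^sup>2)"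
      by (simp add: algebra_simps)
    hence "R\<^sup>2 = quad * (- R * p - X * p\<^sup>2)" unfolding eq by simp
    hence "quad dvd R" by (metis bit_poly_quad_dvd_of_square dvd_triv_left)
    then obtain s where s: "R = quad * s" by (rule dvdE)
    have "quad * (quad * s\<^sup>2 + quad * s * p + X * p\<^sup>2) = 0"
      using eq unfolding s by (simp add: power2_eq_square algebra_simps)
    hence eq2: "quad * s\<^sup>2 + quad * s * p + X * p\<^sup>2 = 0" using quad_nz by (metis mult_eq_0_iff)
    \<comment> \<open>The identity 1 = quad - (1 + X) X shows that X is invertible modulo
      \<open>quad\<close>, so divisibility of X p^2 passes to p^2.\<close>
    have "p\<^sup>2 = quad * p\<^sup>2 - (1 + X) * (X * p\<^sup>2)"
      unfolding qX by (simp add: power2_eq_square algebra_simps)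
    also have "\<dots> = quad * (p\<^sup>2 + (1 + X) * (s\<^sup>2 + s * p)) - (1 + X) * (quad * s\<^sup>2 + quad * s * p + X * p\<^sup>2)"
      by (simp add: algebra_simps)
    also have "\<dots> = quad * (p\<^sup>2 + (1 + X) * (s\<^sup>2 + s * p))" unfolding eq2 by simp
    finally have "quad dvd p" by (metis bit_poly_quad_dvd_of_square dvd_triv_left)
    then obtain p1 where p1: "p = quad * p1" by (rule dvdE)
    have "quad * (s\<^sup>2 + s * quad * p1 + quad * X * p1\<^sup>2) = 0"
      using eq2 unfolding p1 by (simp add: power2_eq_square algebra_simps)
    hence "s\<^sup>2 + s * quad * p1 + quad * X * p1\<^sup>2 = 0" using quad_nz by (metis mult_eq_0_iff)
    moreover have "degree p1 < degree p" using p0 p1 by (simp add: degree_mult_eq)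
    ultimately have "p1 = 0" using less.hyps X_def by blast
    thus False using p0 p1 by simp
  qed
qed

section \<open>The functional equation\<close>

lemma fps_nth_two_mult: "fps_nth (2 * G) n = 2 * fps_nth G n"
  by (simp add: mult_2)

text \<open>The two cases are recorded by t and not by the sign 1 - 2t, because the sign is 1 modulo
  2, while t survives the division by 2 in \<open>artin_schreier\<close> and enters the series
  W.\<close>

locale stern_series =
  fixes t :: int and F :: "int fps"
  assumes t: "t = 0 \<or> t = 1"
    and F_0: "fps_nth F 0 = 1"
    and F_rec: "F = fps_const (2 * t) + fps_const (1 - 2 * t) * (1 + fps_X + fps_X\<^sup>2) * (F oo fps_X\<^sup>2)"
begin

text \<open>Modulo 2 the constant 2t disappears and, by \<open>bit_fps_square\<close>, the
  functional equation reads B = quad B^2 with B non-zero; cancel B.\<close>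

lemma mod_2_inverse:
  obtains V where "(1 + fps_X + fps_X\<^sup>2) * F = 1 + 2 * V"
proof -
  define B :: "bit fps" where "B = fps_of_ints F"
  have "B = (1 + fps_X + fps_X\<^sup>2) * (B oo fps_X\<^sup>2)"
    using arg_cong[OF F_rec, of "fps_of_ints :: int fps \<Rightarrow> bit fps"]
    by (simp add: B_def)
  hence "B = (1 + fps_X + fps_X\<^sup>2) * B * B"
    unfolding bit_fps_square[symmetric] by (simp add: power2_eq_square mult.assoc)
  moreover have "B * ((1 + fps_X + fps_X\<^sup>2) * B - 1) = (1 + fps_X + fps_X\<^sup>2) * B * B - B"
    by (simp only: right_diff_distrib mult_1_right mult_ac)
  ultimately have "B * ((1 + fps_X + fps_X\<^sup>2) * B - 1) = 0" by simp
  moreover have "fps_nth B 0 = 1" by (simp add: B_def F_0)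
  hence "B \<noteq> 0" by auto
  ultimately have "(1 + fps_X + fps_X\<^sup>2) * B = 1" by simp
  hence "fps_of_ints ((1 + fps_X + fps_X\<^sup>2) * F - 1) = (0 :: bit fps)" by (simp add: B_def)
  hence ev: "even (fps_nth ((1 + fps_X + fps_X\<^sup>2) * F - 1) n)" for n
    by (metis fps_of_ints_nth fps_zero_nth of_int_bit_eq_0_iff)
  define V where "V = Abs_fps (\<lambda>n. fps_nth ((1 + fps_X + fps_X\<^sup>2) * F - 1) n div 2)"
  have "fps_nth (2 * V) n = fps_nth ((1 + fps_X + fps_X\<^sup>2) * F - 1) n" for n
    using ev[of n] by (simp add: V_def fps_nth_two_mult del: fps_sub_nth)
  hence "2 * V = (1 + fps_X + fps_X\<^sup>2) * F - 1" by (rule fps_ext)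
  hence "(1 + fps_X + fps_X\<^sup>2) * F = 1 + 2 * V" by simp
  thus thesis by (rule that)
qed

text \<open>Inserting quad F = 1 + 2V into the functional equation cancels everything that is not a
  multiple of 2; halving and reducing modulo 2 leaves a quadratic equation for V. For t = 1 the
  extra term is X + X^2, which the shift of V by X absorbs, so both cases reach the same
  equation.\<close>

lemma artin_schreier:
  assumes V: "(1 + fps_X + fps_X\<^sup>2) * F = 1 + 2 * V"
  defines "W \<equiv> fps_of_ints V + fps_const (of_int t) * fps_X :: bit fps"
  shows "(1 + fps_X + fps_X\<^sup>2) * (W\<^sup>2 + W) = fps_X"
proof -
  define q :: "int fps" where "q = 1 + fps_X + fps_X\<^sup>2"
  define V2 where "V2 = V oo fps_X\<^sup>2"
  define F2 where "F2 = F oo fps_X\<^sup>2"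
  define T where "T = fps_const t"
  have qF: "q * F = 1 + 2 * V" using V by (simp add: q_def)
  have X20: "fps_nth (fps_X\<^sup>2 :: int fps) 0 = 0" by simp
  \<comment> \<open>Here 1 + z^2 + z^4 factors as q(z) q(-z), and \<open>q - 2 * fps_X\<close> is
    q(-z).\<close>
  have "(q oo fps_X\<^sup>2) = 1 + fps_X\<^sup>2 + (fps_X\<^sup>2)\<^sup>2"
    by (simp add: q_def fps_compose_add_distrib fps_compose_power[OF X20, symmetric])
  also have "\<dots> = q * (q - 2 * fps_X)" by (simp add: q_def algebra_simps power2_eq_square)
  finally have "q * (q - 2 * fps_X) = (q oo fps_X\<^sup>2)" by (rule sym)
  hence "q * (q - 2 * fps_X) * F2 = (q * F) oo fps_X\<^sup>2"
    by (simp add: F2_def fps_compose_mult_distrib[OF X20])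
  also have "\<dots> = 1 + 2 * V2"
    by (simp add: qF V2_def fps_compose_add_distrib fps_compose_mult_distrib[OF X20])
  finally have F2: "q * (q - 2 * fps_X) * F2 = 1 + 2 * V2" .
  have F: "F = 2 * T + (1 - 2 * T) * q * F2"
    using F_rec by (simp add: T_def q_def F2_def numeral_fps_const flip: fps_const_mult fps_const_sub)
  have "(q - 2 * fps_X) * (1 + 2 * V) = (q - 2 * fps_X) * (q * (2 * T + (1 - 2 * T) * q * F2))"
    by (simp only: qF[symmetric] F[symmetric])
  also have "\<dots> = 2 * T * q * (q - 2 * fps_X) + (1 - 2 * T) * q * (q * (q - 2 * fps_X) * F2)"
    by (simp add: algebra_simps)
  also have "\<dots> = 2 * T * q * (q - 2 * fps_X) + (1 - 2 * T) * q * (1 + 2 * V2)"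
    unfolding F2 ..
  finally have "2 * (q * V - fps_X - 2 * fps_X * V + q * T) = 2 * (T * q\<^sup>2 - 2 * T * q * fps_X + (1 - 2 * T) * q * V2)"
    by (simp add: algebra_simps power2_eq_square)
  hence "q * V - fps_X - 2 * fps_X * V + q * T = T * q\<^sup>2 - 2 * T * q * fps_X + (1 - 2 * T) * q * V2"
    by (subst (asm) mult_cancel_left) simp
  from arg_cong[OF this, of "fps_of_ints :: int fps \<Rightarrow> bit fps"]
  have eq: "fps_of_ints q * fps_of_ints V - (fps_X :: bit fps) + fps_of_ints q * fps_const (of_int t) =
      fps_const (of_int t) * (fps_of_ints q)\<^sup>2 + fps_of_ints q * (fps_of_ints V)\<^sup>2"
    by (simp add: T_def V2_def bit_fps_square[of "fps_of_ints V"])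
  have q: "fps_of_ints q = (1 + fps_X + fps_X\<^sup>2 :: bit fps)" by (simp add: q_def)
  define v :: "bit fps" where "v = fps_of_ints V"
  define k :: "bit fps" where "k = 1 + fps_X + fps_X\<^sup>2"
  have k: "fps_X\<^sup>2 = k - 1 - fps_X" by (simp add: k_def)
  have neg: "- x = (x :: bit fps)" for x by (rule fps_ext) simp
  from t show ?thesis
  proof
    assume t: "t = 0"
    have "k * (W\<^sup>2 + W) = k * v\<^sup>2 - (k * v - fps_X) + 2 * (k * v) - fps_X"
      by (simp add: W_def t v_def algebra_simps power2_eq_square)
    also have "\<dots> = - fps_X" using eq t unfolding q k_def[symmetric] v_def[symmetric] by simp
    finally show ?thesis by (simp only: neg k_def)
  next
    assume t: "t = 1"
    have "k * (W\<^sup>2 + W) = k * (v\<^sup>2 + 2 * v * fps_X + fps_X\<^sup>2 + v + fps_X)"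
      by (simp add: W_def t v_def algebra_simps power2_eq_square)
    also have "\<dots> = (k\<^sup>2 + k * v\<^sup>2) - (k * v - fps_X + k) + 2 * (k * v + k * v * fps_X) - fps_X"
      unfolding k by (simp add: algebra_simps power2_eq_square)
    also have "\<dots> = - fps_X" using eq t unfolding q k_def[symmetric] v_def[symmetric] by simp
    finally show ?thesis by (simp only: neg k_def)
  qed
qed

text \<open>Modulo 2 the form $qF - p$ becomes a linear form $R + ap\,W$ in the quadratic series $W$, and a
  high order of vanishing would force the norm of that linear form, a polynomial of small degree, to
  be zero.\<close>
lemma linear_form_nonzero_coeff:
  assumes "p \<noteq> 0 \<or> q \<noteq> 0" "degree p \<le> n" "degree q \<le> n"
  shows "\<exists>j<2 * n + 7. fps_nth (fps_of_poly q * F - fps_of_poly p) j \<noteq> 0"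
proof -
  \<comment> \<open>At this fixed index one coefficient is non-zero, so halving p and q strictly
    decreases the measure. The descent thus reduces to the case that 2 does not divide both
    polynomials.\<close>
  obtain i where "coeff p i \<noteq> 0 \<or> coeff q i \<noteq> 0" using assms(1) by (metis leading_coeff_0_iff)
  thus ?thesis using assms(2,3)
  proof (induction "nat (\<bar>coeff p i\<bar> + \<bar>coeff q i\<bar>)" arbitrary: p q rule: less_induct)
    case less
    show ?case
    proof (cases "[:2:] dvd p \<and> [:2:] dvd q")
      case True
      then obtain p' q' where pq: "p = Polynomial.smult 2 p'" "q = Polynomial.smult 2 q'" by (auto elim!: dvdE)
      have "\<exists>j<2 * n + 7. fps_nth (fps_of_poly q' * F - fps_of_poly p') j \<noteq> 0"
        using less.prems unfolding pq by (intro less.hyps) (auto simp: pq abs_mult)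
      moreover have "fps_of_poly q * F - fps_of_poly p = fps_const 2 * (fps_of_poly q' * F - fps_of_poly p')"
        by (simp add: pq fps_of_poly_smult algebra_simps)
      ultimately show ?thesis by auto
    next
      case False
      show ?thesis
      proof (rule ccontr)
        assume "\<not> ?thesis"
        hence D0: "fps_nth (fps_of_poly q * F - fps_of_poly p) j = 0" if "j < 2 * n + 7" for j
          using that by blast
        obtain V where V: "(1 + fps_X + fps_X\<^sup>2) * F = 1 + 2 * V" by (rule mod_2_inverse)
        have aD0: "fps_nth (A * (fps_of_poly q * F - fps_of_poly p)) j = 0" if "j < 2 * n + 7" for A j
          unfolding fps_mult_nth using D0 that by (intro sum.neutral) (auto simp del: fps_sub_nth)
        have "fps_of_poly quad * (fps_of_poly q * F - fps_of_poly p) =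
            fps_of_poly q * (fps_of_poly quad * F) - fps_of_poly (quad * p)"
          by (simp add: fps_of_poly_mult algebra_simps)
        also have "\<dots> = fps_of_poly (q - quad * p) + 2 * fps_of_poly q * V"
          unfolding fps_of_poly_quad V by (simp add: fps_of_poly_diff algebra_simps)
        finally have aD: "fps_of_poly quad * (fps_of_poly q * F - fps_of_poly p) =
            fps_of_poly (q - quad * p) + 2 * fps_of_poly q * V" .
        have dqp: "degree (q - quad * p) \<le> n + 2"
          using less.prems degree_mult_le[of quad p] by (intro degree_diff_le) auto
        have "even (coeff (q - quad * p) j)" for j
        proof (cases "j < 2 * n + 7")
          case True
          have "coeff (q - quad * p) j = fps_nth (fps_of_poly (q - quad * p)) j" by simp
          also have "\<dots> = - (2 * fps_nth (fps_of_poly q * V) j)"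
            using aD0[OF True, of "fps_of_poly quad"] unfolding aD
            by (simp add: fps_nth_two_mult mult.assoc)
          finally show ?thesis by simp
        next
          case False
          thus ?thesis using dqp by (subst coeff_eq_0) auto
        qed
        hence "[:2:] dvd q - quad * p" by (simp add: const_poly_dvd_iff)
        then obtain r where r: "q - quad * p = Polynomial.smult 2 r" by (auto elim!: dvdE)
        have dr: "degree r \<le> n + 2" using dqp unfolding r by simp
        have rV: "fps_nth (fps_of_poly r + fps_of_poly q * V) j = 0" if "j < 2 * n + 7" for j
          using aD0[OF that, of "fps_of_poly quad"] unfolding aD r
          by (simp add: fps_of_poly_smult fps_nth_two_mult mult.assoc)
        define B :: "int poly \<Rightarrow> bit poly" where "B = map_poly of_int"
        have deg_B: "degree (B f) \<le> degree f" for f by (intro degree_le) (auto simp: B_def coeff_map_poly coeff_eq_0)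
        define v W k P :: "bit fps" where "v = fps_of_ints V" and "W = v + fps_const (of_int t) * fps_X"
          and "k = fps_of_poly quad" and "P = fps_of_poly (B p)"
        define X :: "bit poly" where "X = [:0, 1:]"
        have X: "fps_of_poly X = fps_X" "degree X = 1" by (simp_all add: X_def)
        define R where "R = B r + Polynomial.smult (of_int t) (B p) * quad * X"
        \<comment> \<open>This is the norm of R + quad (B p) W. That linear form is the series
          \<open>G\<close> below, which vanishes to order 2n + 7, whereas deg R \<le> n + 3 gives
          deg N \<le> 2n + 6; this comparison is the source of the constant 7.\<close>
        define N where "N = R\<^sup>2 + R * quad * B p + quad * X * (B p)\<^sup>2"
        have W: "k * (W\<^sup>2 + W) = fps_X"
          using artin_schreier[OF V] by (simp add: W_def v_def k_def fps_of_poly_quad)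
        have "fps_of_ints (fps_of_poly q - fps_of_poly quad * fps_of_poly p) =
            (fps_of_ints (fps_const 2 * fps_of_poly r) :: bit fps)"
          using r by (metis fps_of_poly_diff fps_of_poly_mult fps_of_poly_smult)
        hence Bq: "fps_of_poly (B q) = k * P"
          by (simp add: fps_of_poly_quad B_def k_def P_def)
        define G :: "bit fps" where "G = fps_of_ints (fps_of_poly r + fps_of_poly q * V)"
        have G0: "fps_nth (G * A) j = 0" if "j < 2 * n + 7" for A j
          unfolding fps_mult_nth using rV that by (intro sum.neutral) (auto simp: G_def simp del: fps_add_nth fps_of_ints_add)
        have "G = fps_of_poly (B r) + k * P * v"
          by (simp add: G_def v_def Bq flip: B_def)
        also have "\<dots> = fps_of_poly (B r) + k * P * W - fps_const (of_int t) * k * P * fps_X"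
          by (simp add: W_def algebra_simps)
        finally have "fps_of_poly R = G - k * P * W + 2 * (fps_const (of_int t) * k * P * fps_X)"
          by (simp add: R_def k_def P_def fps_of_poly_add fps_of_poly_mult fps_of_poly_smult X algebra_simps del: bit_fps_two)
        hence RG: "fps_of_poly R = G - k * P * W" by simp
        have "fps_of_poly N = (G - k * P * W)\<^sup>2 + (G - k * P * W) * k * P + k * fps_X * P\<^sup>2"
          by (simp add: N_def fps_of_poly_add fps_of_poly_mult fps_of_poly_power RG X flip: k_def P_def)
        \<comment> \<open>An identity valid in every commutative ring; the terms collected behind
          the factor 2 drop out in the next step.\<close>
        also have "\<dots> = G * (G + k * P) + k * P\<^sup>2 * (k * (W\<^sup>2 + W)) + k * P\<^sup>2 * fps_X
            + 2 * (- G * k * P * W - k\<^sup>2 * P\<^sup>2 * W)"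
          by (simp add: algebra_simps power2_eq_square del: bit_fps_two)
        also have "\<dots> = G * (G + k * P) + 2 * (k * P\<^sup>2 * fps_X)"
          unfolding W by (subst (2) mult_2) simp
        finally have NG: "fps_of_poly N = G * (G + k * P)" by simp
        have dR: "degree R \<le> n + 3"
          unfolding R_def
        proof (intro degree_add_le)
          show "degree (B r) \<le> n + 3" using deg_B[of r] dr by linarith
          have "degree (Polynomial.smult (of_int t) (B p) * quad * X) \<le> degree (Polynomial.smult (of_int t) (B p)) + 2 + 1"
            by (intro degree_mult_le[THEN order_trans] add_mono) (auto simp: X)
          also have "\<dots> \<le> n + 3" using deg_B[of p] less.prems degree_smult_le[of "of_int t" "B p"] by linarith
          finally show "degree (Polynomial.smult (of_int t) (B p) * quad * X) \<le> n + 3" .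
        qed
        have dp: "degree (B p) \<le> n" using deg_B[of p] less.prems by linarith
        have "degree N \<le> 2 * n + 6"
          unfolding N_def
        proof (intro degree_add_le)
          show "degree (R\<^sup>2) \<le> 2 * n + 6" using dR degree_power_le[of R 2] by linarith
          show "degree (R * quad * B p) \<le> 2 * n + 6"
            using dR dp degree_mult_le[of "R * quad" "B p"] degree_mult_le[of R "quad"] by simp
          have "degree (quad * X * (B p)\<^sup>2) \<le> 2 + 1 + degree ((B p)\<^sup>2)"
            by (intro degree_mult_le[THEN order_trans] add_mono) (auto simp: X)
          thus "degree (quad * X * (B p)\<^sup>2) \<le> 2 * n + 6"
            using dp degree_power_le[of "B p" 2] by linarith
        qed
        hence "coeff N j = 0" for j
          using G0[of j "G + k * P"] by (cases "j < 2 * n + 7") (auto simp: coeff_eq_0 simp flip: NG)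
        hence "N = 0" by (intro poly_eqI) simp
        hence Bp: "B p = 0" unfolding N_def X_def by (rule bit_poly_norm_form_nonzero)
        hence "B q = 0" using Bq fps_of_poly_eq_iff[of "B q" 0] by (simp add: P_def)
        have "[:2:] dvd f" if "B f = 0" for f
        proof -
          have "of_int (coeff f j) = (0 :: bit)" for j
            using arg_cong[OF that, of "\<lambda>g. coeff g j"] by (simp add: B_def coeff_map_poly)
          thus ?thesis by (simp add: const_poly_dvd_iff of_int_bit_eq_0_iff)
        qed
        thus False using False Bp \<open>B q = 0\<close> by blast
      qed
    qed
  qed
qed

end

section \<open>Substitution of z^2, Pade approximants, and transcendence over the rational
  functions\<close>

lemma fps_of_poly_pcompose_X2:
  "fps_of_poly (pcompose p [:0, 0, 1:]) = (fps_of_poly p oo fps_X\<^sup>2 :: 'a::idom fps)"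
proof -
  have "fps_of_poly [:0, 0, 1 :: 'a:] = fps_X\<^sup>2"
    by (simp add: fps_of_poly_pCons power2_eq_square)
  thus ?thesis by (subst (asm) eq_commute) (simp only: fps_of_poly_pcompose coeff_pCons_0)
qed

lemma subdegree_compose_X2:
  fixes f :: "'a::idom fps"
  assumes "f \<noteq> 0"
  shows "subdegree (f oo fps_X\<^sup>2) = 2 * subdegree f" "fps_nth (f oo fps_X\<^sup>2) (2 * subdegree f) = fps_nth f (subdegree f)"
    "f oo fps_X\<^sup>2 \<noteq> 0"
proof -
  show 1: "fps_nth (f oo fps_X\<^sup>2) (2 * subdegree f) = fps_nth f (subdegree f)"
    by (simp add: fps_nth_compose_X_power)
  show "subdegree (f oo fps_X\<^sup>2) = 2 * subdegree f"
  proof (rule subdegreeI)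
    show "fps_nth (f oo fps_X\<^sup>2) (2 * subdegree f) \<noteq> 0" using 1 assms by simp
    show "fps_nth (f oo fps_X\<^sup>2) i = 0" if "i < 2 * subdegree f" for i
      using that nth_less_subdegree_zero[of "i div 2" f] by (simp add: fps_nth_compose_X_power)
  qed
  show "f oo fps_X\<^sup>2 \<noteq> 0" using 1 assms by auto
qed

lemma pcompose_power: "pcompose (p ^ n) r = pcompose p r ^ n" for p r :: "'a::comm_ring_1 poly"
  by (induction n) (simp_all add: pcompose_mult pcompose_1)

lemma fps_of_poly_of_nat: "fps_of_poly (of_nat n) = of_nat n"
  by (induction n) (simp_all add: fps_of_poly_add)

lemma sum_binomial_shift:
  fixes u :: "nat \<Rightarrow> 'a::comm_ring_1"
  shows "(\<Sum>i\<le>d. u i * (y - c) ^ i) = (\<Sum>j\<le>d. (\<Sum>i\<le>d. of_nat (i choose j) * (- c) ^ (i - j) * u i) * y ^ j)"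
proof -
  have "(\<Sum>i\<le>d. u i * (y - c) ^ i) = (\<Sum>i\<le>d. u i * (\<Sum>j\<le>d. of_nat (i choose j) * (- c) ^ (i - j) * y ^ j))"
  proof (intro sum.cong refl)
    fix i assume i: "i \<in> {..d}"
    have "(y - c) ^ i = (\<Sum>j\<le>i. of_nat (i choose j) * y ^ j * (- c) ^ (i - j))"
      using binomial_ring[of y "- c" i] by simp
    \<comment> \<open>A common range for all i is needed to exchange the two sums. For j > i the
      binomial coefficient vanishes, so the truncated difference i - j does no harm.\<close>
    also have "\<dots> = (\<Sum>j\<le>d. of_nat (i choose j) * y ^ j * (- c) ^ (i - j))"
      using i by (intro sum.mono_neutral_left) (simp_all add: binomial_eq_0)
    finally show "u i * (y - c) ^ i = u i * (\<Sum>j\<le>d. of_nat (i choose j) * (- c) ^ (i - j) * y ^ j)"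
      by (simp add: mult_ac)
  qed
  also have "\<dots> = (\<Sum>j\<le>d. (\<Sum>i\<le>d. of_nat (i choose j) * (- c) ^ (i - j) * u i) * y ^ j)"
    by (rule sum_mult_sum_swap)
  finally show ?thesis .
qed

text \<open>Compare the leading coefficients at 1, where $1 + z + z^2$ takes the value 3 while
  $(z^2 - 1)/(z - 1)$ takes the value 2.\<close>
lemma quad_power_coboundary:
  fixes f g :: "int poly"
  assumes "f \<noteq> 0" "g \<noteq> 0"
    and eq: "pcompose f [:0, 0, 1:] * g = f * (pcompose g [:0, 0, 1:] * quad ^ m)"
  shows "m = 0"
proof -
  define L :: "int poly" where "L = [:- 1, 1:]"
  define M :: "int poly" where "M = [:1, 1:]"
  have L2: "pcompose L [:0, 0, 1:] = L * M" by (simp add: L_def M_def pcompose_pCons)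
  obtain e f' where f: "f = L ^ e * f'" "poly f' 1 \<noteq> 0"
    using order_decomp[OF assms(1), of 1] by (auto simp: L_def poly_eq_0_iff_dvd)
  obtain h g' where g: "g = L ^ h * g'" "poly g' 1 \<noteq> 0"
    using order_decomp[OF assms(2), of 1] by (auto simp: L_def poly_eq_0_iff_dvd)
  have "L ^ (e + h) * (M ^ e * pcompose f' [:0, 0, 1:] * g') = L ^ (e + h) * (f' * (M ^ h * pcompose g' [:0, 0, 1:] * quad ^ m))"
    using eq unfolding f(1) g(1)
    by (simp add: pcompose_mult pcompose_power L2 power_add power_mult_distrib mult_ac)
  moreover have "L ^ (e + h) \<noteq> 0" by (simp add: L_def)
  ultimately have "M ^ e * pcompose f' [:0, 0, 1:] * g' = f' * (M ^ h * pcompose g' [:0, 0, 1:] * quad ^ m)"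
    by (metis mult_left_cancel)
  from arg_cong[OF this, of "\<lambda>p. poly p 1"] have "2 ^ e = (2 ^ h * 3 ^ m :: int)"
    using f(2) g(2) by (simp add: poly_pcompose M_def quad_def)
  show "m = 0"
  proof (rule ccontr)
    assume "m \<noteq> 0"
    hence "(3::int) dvd 2 ^ e" using \<open>2 ^ e = (2 ^ h * 3 ^ m :: int)\<close> by (simp add: dvd_power)
    moreover have "prime (3::int)" by simp
    ultimately have "(3::int) dvd 2" using prime_dvd_power by blast
    thus False by simp
  qed
qed

context stern_series
begin

lemma pade_approximant:
  obtains p q where "q \<noteq> 0" "degree p \<le> n" "degree q \<le> n"
    "\<And>j. j \<le> 2 * n \<Longrightarrow> fps_nth (fps_of_poly q * F - fps_of_poly p) j = 0"
proof -
  \<comment> \<open>The unknowns are the n + 1 coefficients of q, and equation i is the vanishing of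
    the coefficient of qF at order n + 1 + i. Orders up to n are matched by taking p as the
    truncation of qF.\<close>
  obtain x :: "nat \<Rightarrow> int" where x: "\<exists>j<Suc n. x j \<noteq> 0"
    "\<And>i. i < n \<Longrightarrow> (\<Sum>j<Suc n. fps_nth F (n + 1 + i - j) * x j) = 0"
    using nontrivial_int_solution[of n "Suc n" "\<lambda>i j. fps_nth F (n + 1 + i - j)"] by auto
  define q where "q = (\<Sum>j\<le>n. monom (x j) j)"
  have cq: "coeff q j = (if j \<le> n then x j else 0)" for j
    by (simp add: q_def coeff_sum)
  define p where "p = truncate_fps (Suc n) (fps_of_poly q * F)"
  show thesis
  proof (rule that[of q p])
    show "q \<noteq> 0" using x(1) cq by (metis coeff_0 less_Suc_eq_le)
    show "degree q \<le> n" by (rule degree_le) (simp add: cq)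
    show "degree p \<le> n" by (rule degree_le) (simp add: p_def coeff_truncate_fps)
    fix j assume j: "j \<le> 2 * n"
    show "fps_nth (fps_of_poly q * F - fps_of_poly p) j = 0"
    proof (cases "j \<le> n")
      case True
      thus ?thesis by (simp add: p_def)
    next
      case False
      have "fps_nth (fps_of_poly q * F) j = (\<Sum>i\<le>j. coeff q i * fps_nth F (j - i))"
        by (simp add: fps_mult_nth atMost_atLeast0)
      also have "\<dots> = (\<Sum>i<Suc n. coeff q i * fps_nth F (j - i))"
        using False by (intro sum.mono_neutral_right) (auto simp: cq)
      also have "\<dots> = (\<Sum>i<Suc n. fps_nth F (n + 1 + (j - n - 1) - i) * x i)"
        using False by (intro sum.cong) (auto simp: cq)
      also have "\<dots> = 0" using False j by (intro x(2)) auto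
      finally show ?thesis using False by (simp add: p_def)
    qed
  qed
qed

text \<open>There are (N + 1)^2 free coefficients against N^2 + 2N linear conditions. The pair of
  exponents (l of z, i of F) is coded as e = i * n + l with n = N + 1.\<close>

lemma auxiliary_polynomial:
  obtains P :: "nat \<Rightarrow> int poly" where "\<exists>i\<le>N. P i \<noteq> 0" "\<And>i. degree (P i) \<le> N"
    "\<And>j. j < N\<^sup>2 + 2 * N \<Longrightarrow> fps_nth (\<Sum>i\<le>N. fps_of_poly (P i) * F ^ i) j = 0"
proof -
  define n where "n = Suc N"
  have n: "n > 0" by (simp add: n_def)
  have n2: "N\<^sup>2 + 2 * N < n * n" by (simp add: n_def power2_eq_square)
  obtain x :: "nat \<Rightarrow> int" where x: "\<exists>e<n * n. x e \<noteq> 0"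
    "\<And>j. j < N\<^sup>2 + 2 * N \<Longrightarrow> (\<Sum>e<n * n. fps_nth (fps_X ^ (e mod n) * F ^ (e div n)) j * x e) = 0"
    using nontrivial_int_solution[OF n2, of "\<lambda>j e. fps_nth (fps_X ^ (e mod n) * F ^ (e div n)) j"] by auto
  define P where "P i = (\<Sum>l<n. monom (x (i * n + l)) l)" for i
  have cP: "coeff (P i) l = (if l < n then x (i * n + l) else 0)" for i l
    by (simp add: P_def coeff_sum)
  show thesis
  proof (rule that[of P])
    obtain e where e: "e < n * n" "x e \<noteq> 0" using x(1) by blast
    have "coeff (P (e div n)) (e mod n) \<noteq> 0" using e by (simp add: cP n)
    moreover have "e div n \<le> N" using e(1) by (simp add: n_def less_mult_imp_div_less flip: less_Suc_eq_le)
    ultimately show "\<exists>i\<le>N. P i \<noteq> 0" by (metis coeff_0)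
    show "degree (P i) \<le> N" for i
      by (rule degree_le) (auto simp: cP n_def)
    fix j assume j: "j < N\<^sup>2 + 2 * N"
    have "(\<Sum>i\<le>N. fps_of_poly (P i) * F ^ i) = (\<Sum>i<n. \<Sum>l<n. fps_const (x (i * n + l)) * (fps_X ^ l * F ^ i))"
      unfolding P_def n_def lessThan_Suc_atMost
      by (simp add: fps_of_poly_sum fps_of_poly_monom sum_distrib_right mult.assoc)
    also have "\<dots> = (\<Sum>i<n. \<Sum>e = i * n..<i * n + n. fps_const (x e) * (fps_X ^ (e mod n) * F ^ (e div n)))"
    proof (rule sum.cong[OF refl])
      fix i
      show "(\<Sum>l<n. fps_const (x (i * n + l)) * (fps_X ^ l * F ^ i)) =
        (\<Sum>e = i * n..<i * n + n. fps_const (x e) * (fps_X ^ (e mod n) * F ^ (e div n)))"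
        using sum.shift_bounds_nat_ivl[of "\<lambda>e. fps_const (x e) * (fps_X ^ (e mod n) * F ^ (e div n))" 0 "i * n" n]
        by (simp add: atLeast0LessThan add.commute)
    qed
    also have "\<dots> = (\<Sum>e<n * n. fps_const (x e) * (fps_X ^ (e mod n) * F ^ (e div n)))"
      by (rule sum.nat_group)
    finally have "fps_nth (\<Sum>i\<le>N. fps_of_poly (P i) * F ^ i) j = (\<Sum>e<n * n. fps_nth (fps_X ^ (e mod n) * F ^ (e div n)) j * x e)"
      by (simp add: fps_sum_nth mult.commute)
    thus "fps_nth (\<Sum>i\<le>N. fps_of_poly (P i) * F ^ i) j = 0" using x(2)[OF j] by simp
  qed
qed

lemma no_linear_relation:
  assumes "fps_of_poly q * F = fps_of_poly p"
  shows "p = 0" "q = 0"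
proof -
  have "p = 0 \<and> q = 0"
    using linear_form_nonzero_coeff[of p q "degree p + degree q"] assms by auto
  thus "p = 0" "q = 0" by auto
qed

text \<open>Substituting z^2 in a minimal relation and returning to F by the functional equation
  yields a second relation of the same degree, which minimality makes proportional to the first. For
  t = 0 a single lower coefficient then makes a positive power of \<open>quad\<close> a quotient of
  the form g(z^2) / g(z) with g rational. For t = 1 the coefficient of index d - 1 yields a rational
  solution of the inhomogeneous equation, and it must coincide with F.\<close>

lemma transcendental:
  assumes "(\<Sum>i\<le>N. fps_of_poly (P i) * F ^ i) = 0" "i \<le> N"
  shows "P i = 0"
proof (rule ccontr)
  assume "P i \<noteq> 0"
  obtain d and p :: "nat \<Rightarrow> int poly" where d: "d > 0" "p d \<noteq> 0" "(\<Sum>i\<le>d. fps_of_poly (p i) * F ^ i) = 0"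
    and indep: "\<And>w i. (\<Sum>i<d. fps_of_poly (w i) * F ^ i) = 0 \<Longrightarrow> i < d \<Longrightarrow> w i = 0"
    by (rule minimal_relation[of fps_of_poly i N P F])
      (use assms \<open>P i \<noteq> 0\<close> in \<open>auto simp: fps_of_poly_eq_iff simp flip: fps_of_poly_0\<close>)
  define p2 where "p2 i = pcompose (p i) [:0, 0, 1:]" for i
  define c s :: "int poly" where "c = [:2 * t:]" and "s = [:1 - 2 * t:] * quad"
  define F2 where "F2 = F oo fps_X\<^sup>2"
  \<comment> \<open>Since F(z^2) = (F - c) / s, multiplying the substituted relation by s^d and
    expanding in powers of F gives these coefficients.\<close>
  define Q where "Q j = (\<Sum>i\<le>d. of_nat (i choose j) * (- c) ^ (i - j) * (p2 i * s ^ (d - i)))" for j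
  have F: "F - fps_of_poly c = fps_of_poly s * F2"
    using F_rec[THEN arg_cong, of "\<lambda>G. G - fps_const (2 * t)"]
    by (simp add: F2_def s_def c_def fps_of_poly_smult fps_of_poly_quad fps_of_poly_const mult.assoc)
  have X20: "fps_nth (fps_X\<^sup>2 :: int fps) 0 = 0" by simp
  have "(\<Sum>i\<le>d. fps_of_poly (p2 i) * F2 ^ i) = (\<Sum>i\<le>d. fps_of_poly (p i) * F ^ i) oo fps_X\<^sup>2"
    by (simp add: fps_compose_sum_distrib fps_compose_mult_distrib[OF X20] fps_compose_power[OF X20]
        p2_def F2_def fps_of_poly_pcompose_X2)
  hence rel2: "(\<Sum>i\<le>d. fps_of_poly (p2 i) * F2 ^ i) = 0" using d(3) by simp
  have "(\<Sum>j\<le>d. fps_of_poly (Q j) * F ^ j) = (\<Sum>i\<le>d. fps_of_poly (p2 i * s ^ (d - i)) * (F - fps_of_poly c) ^ i)"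
    unfolding sum_binomial_shift
    by (simp add: Q_def fps_of_poly_sum fps_of_poly_mult fps_of_poly_power fps_of_poly_uminus fps_of_poly_of_nat)
  also have "\<dots> = (\<Sum>i\<le>d. fps_of_poly s ^ d * (fps_of_poly (p2 i) * F2 ^ i))"
  proof (intro sum.cong refl)
    fix i assume "i \<in> {..d}"
    hence "fps_of_poly s ^ d = fps_of_poly s ^ (d - i) * fps_of_poly s ^ i"
      by (simp flip: power_add)
    thus "fps_of_poly (p2 i * s ^ (d - i)) * (F - fps_of_poly c) ^ i = fps_of_poly s ^ d * (fps_of_poly (p2 i) * F2 ^ i)"
      by (simp add: F fps_of_poly_mult fps_of_poly_power power_mult_distrib)
  qed
  also have "\<dots> = 0" using rel2 by (simp flip: sum_distrib_left)
  finally have relQ: "(\<Sum>j\<le>d. fps_of_poly (Q j) * F ^ j) = 0" .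
  have Qd: "Q d = p2 d"
  proof -
    have "Q d = (\<Sum>i\<in>{d}. of_nat (i choose d) * (- c) ^ (i - d) * (p2 i * s ^ (d - i)))"
      unfolding Q_def by (intro sum.mono_neutral_right) (auto simp: binomial_eq_0)
    thus ?thesis by simp
  qed
  \<comment> \<open>This combination of the two relations cancels the top coefficient, so
    independence of the lower powers applies.\<close>
  have "p2 d * p j - p d * Q j = 0" if "j < d" for j
  proof (rule indep[OF _ that, of "\<lambda>j. p2 d * p j - p d * Q j"])
    have "(\<Sum>j\<le>d. fps_of_poly (p2 d * p j - p d * Q j) * F ^ j) =
      fps_of_poly (p2 d) * (\<Sum>j\<le>d. fps_of_poly (p j) * F ^ j) - fps_of_poly (p d) * (\<Sum>j\<le>d. fps_of_poly (Q j) * F ^ j)"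
      by (simp add: fps_of_poly_mult fps_of_poly_diff sum_distrib_left sum_subtractf algebra_simps)
    hence "(\<Sum>j\<le>d. fps_of_poly (p2 d * p j - p d * Q j) * F ^ j) = 0" using d(3) relQ by simp
    thus "(\<Sum>j<d. fps_of_poly (p2 d * p j - p d * Q j) * F ^ j) = 0"
      by (simp add: Qd mult.commute flip: lessThan_Suc_atMost)
  qed
  hence eq: "p2 d * p j = p d * Q j" if "j < d" for j using that by simp
  from t show False
  proof
    assume t: "t = 0"
    have "\<exists>j<d. p j \<noteq> 0"
    proof (rule ccontr)
      assume "\<not> (\<exists>j<d. p j \<noteq> 0)"
      hence "fps_of_poly (p d) * F ^ d = 0" using d(3) by (simp flip: lessThan_Suc_atMost)
      moreover have "F \<noteq> 0" using F_0 by auto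
      ultimately show False using d(2) fps_of_poly_eq_iff[of "p d" 0] by simp
    qed
    then obtain j where j: "j < d" "p j \<noteq> 0" by blast
    have "Q j = (\<Sum>i\<in>{j}. of_nat (i choose j) * (- c) ^ (i - j) * (p2 i * s ^ (d - i)))"
      unfolding Q_def
    proof (intro sum.mono_neutral_right)
      show "\<forall>i\<in>{..d} - {j}. of_nat (i choose j) * (- c) ^ (i - j) * (p2 i * s ^ (d - i)) = 0"
      proof
        fix i assume "i \<in> {..d} - {j}"
        hence "i < j \<or> i > j" by auto
        thus "of_nat (i choose j) * (- c) ^ (i - j) * (p2 i * s ^ (d - i)) = 0"
          by (auto simp: binomial_eq_0 c_def t)
      qed
    qed (use j in auto)
    hence "Q j = p2 j * quad ^ (d - j)" by (simp add: s_def t)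
    hence "d - j = 0"
      using eq[OF j(1)] d(2) j(2) unfolding p2_def by (intro quad_power_coboundary[of "p d" "p j"]) auto
    thus False using j(1) by simp
  next
    assume t: "t = 1"
    have choose: "d choose (d - Suc 0) = d" using d(1) by (cases d) simp_all
    have "Q (d - 1) = (\<Sum>i\<in>{d - 1, d}. of_nat (i choose (d - 1)) * (- c) ^ (i - (d - 1)) * (p2 i * s ^ (d - i)))"
      unfolding Q_def by (intro sum.mono_neutral_right) (auto simp: binomial_eq_0)
    also have "\<dots> = - (p2 (d - 1) * quad) - 2 * of_nat d * p2 d"
      using d(1) choose by (simp add: c_def s_def t numeral_poly)
    finally have Q: "Q (d - 1) = - (p2 (d - 1) * quad) - 2 * of_nat d * p2 d" .
    \<comment> \<open>The quotient u / v is the mean of the roots of the minimal relation. Averaging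
      respects the affine functional equation, so u / v satisfies the same equation as F.\<close>
    define v u where "v = of_nat d * p d" and "u = - p (d - 1)"
    define v2 u2 where "v2 = of_nat d * p2 d" and "u2 = - p2 (d - 1)"
    have "v2 * u = - (of_nat d * (p2 d * p (d - 1)))" by (simp add: v2_def u_def mult_ac)
    also have "\<dots> = - (of_nat d * (p d * Q (d - 1)))" using eq[of "d - 1"] d(1) by simp
    also have "\<dots> = v * (2 * v2 - quad * u2)"
      unfolding Q by (simp add: v_def v2_def u2_def algebra_simps)
    finally have vu: "fps_of_poly v2 * fps_of_poly u = fps_of_poly v * (2 * fps_of_poly v2 - fps_of_poly quad * fps_of_poly u2)"
      by (metis fps_of_poly_mult fps_of_poly_diff fps_of_poly_numeral)
    define D where "D = fps_of_poly v * F - fps_of_poly u"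
    have v2: "fps_of_poly v2 = fps_of_poly v oo fps_X\<^sup>2"
      by (simp add: v2_def v_def p2_def fps_of_poly_mult fps_of_poly_of_nat fps_compose_mult_distrib[OF X20] fps_of_poly_pcompose_X2)
    have u2: "fps_of_poly u2 = fps_of_poly u oo fps_X\<^sup>2"
      by (simp add: u2_def u_def p2_def fps_of_poly_uminus fps_of_poly_pcompose_X2 fps_compose_uminus)
    have D2: "D oo fps_X\<^sup>2 = fps_of_poly v2 * F2 - fps_of_poly u2"
      by (simp add: D_def fps_compose_sub_distrib fps_compose_mult_distrib[OF X20] v2 u2 F2_def)
    have F': "F = 2 - fps_of_poly quad * F2"
      using F by (simp add: c_def s_def t fps_of_poly_mult fps_of_poly_uminus fps_of_poly_const numeral_fps_const algebra_simps)
    have "fps_of_poly v2 * D = fps_of_poly v2 * fps_of_poly v * F - fps_of_poly v2 * fps_of_poly u"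
      by (simp add: D_def algebra_simps)
    also have "\<dots> = - fps_of_poly quad * fps_of_poly v * (fps_of_poly v2 * F2 - fps_of_poly u2)"
      unfolding vu by (subst F') (simp add: algebra_simps)
    finally have eqD: "fps_of_poly v2 * D = - fps_of_poly quad * fps_of_poly v * (D oo fps_X\<^sup>2)"
      unfolding D2 .
    have v0: "fps_of_poly v \<noteq> 0" using d(1,2) by (simp add: v_def fps_of_poly_eq_iff flip: fps_of_poly_0)
    \<comment> \<open>The difference h = F - u / v = D / v satisfies h(z) = - quad(z) h(z^2).
      Comparing lowest coefficients, in the form without denominators, makes one equal to its own
      negative.\<close>
    have "D = 0"
    proof (rule ccontr)
      assume D: "D \<noteq> 0"
      define V where "V = fps_of_poly v"
      define k :: "int fps" where "k = - fps_of_poly quad"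
      have V: "V \<noteq> 0" using v0 by (simp add: V_def)
      have eqD: "(V oo fps_X\<^sup>2) * D = k * V * (D oo fps_X\<^sup>2)"
        using eqD unfolding v2 V_def k_def .
      have k0: "fps_nth k 0 = - 1" by (simp add: k_def quad_def)
      hence k: "subdegree k = 0" "k \<noteq> 0" by auto
      have kV: "k * V \<noteq> 0" "subdegree (k * V) = subdegree V"
        using k V by simp_all
      have kV_nth: "fps_nth (k * V) (subdegree V) = - fps_nth V (subdegree V)"
        using nth_subdegree_mult[of k V] k k0 by simp
      note sub = subdegree_compose_X2[OF D] subdegree_compose_X2[OF V]
      have l: "subdegree (V oo fps_X\<^sup>2) + subdegree D = subdegree (k * V) + subdegree (D oo fps_X\<^sup>2)"
        using arg_cong[OF eqD, of subdegree] D kV(1) sub by simp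
      have "fps_nth ((V oo fps_X\<^sup>2) * D) (subdegree (V oo fps_X\<^sup>2) + subdegree D) =
          fps_nth (k * V * (D oo fps_X\<^sup>2)) (subdegree (k * V) + subdegree (D oo fps_X\<^sup>2))"
        by (simp only: l eqD)
      hence "fps_nth V (subdegree V) * fps_nth D (subdegree D) = - fps_nth V (subdegree V) * fps_nth D (subdegree D)"
        unfolding nth_subdegree_mult unfolding kV(2) kV_nth sub by simp
      thus False using D V by simp
    qed
    hence "fps_of_poly v * F = fps_of_poly u" by (simp add: D_def)
    thus False using no_linear_relation(2)[of v u] v0 by simp
  qed
qed

end

section \<open>A criterion for irrationality exponent 2\<close>

text \<open>An approximation $P/Q$ with $|Q\xi - P| < 1/(2q)$ either differs from $p/q$, and then $|q\xi - p| \ge 1/(2|Q|)$, or equals it, and then the lower bound for $|Q\xi - P|$ transfers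
  to $|q\xi - p|$.\<close>
lemma distance_to_fraction:
  fixes \<xi> X :: real and C :: nat
  assumes X: "X \<ge> 1" and m: "m \<ge> 1" and q: "q > 0" "2 * real_of_int q < X ^ m" "X ^ (m - 1) \<le> 2 * real_of_int q"
    and Q: "\<bar>real_of_int Q\<bar> \<le> X ^ (m + 6)" "\<bar>of_int Q * \<xi> - of_int P\<bar> * X ^ m \<le> 1"
      "1 \<le> \<bar>of_int Q * \<xi> - of_int P\<bar> * X ^ (m + C)"
  shows "1 \<le> 4 * real_of_int q * X ^ (C + 8) * \<bar>of_int q * \<xi> - of_int p\<bar>"
proof -
  define A where "A = \<bar>of_int Q * \<xi> - of_int P\<bar>"
  define D where "D = \<bar>of_int q * \<xi> - of_int p\<bar>"
  have A0: "A \<ge> 0" and D0: "D \<ge> 0" by (simp_all add: A_def D_def)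
  have mC: "X ^ (m + C + 7) = X ^ (m - 1) * X ^ (C + 8)"
  proof -
    have "m + C + 7 = m - 1 + (C + 8)" using m by simp
    thus ?thesis by (simp only: power_add)
  qed
  have eq: "of_int Q * (of_int q * \<xi> - of_int p) = of_int q * (of_int Q * \<xi> - of_int P) + of_int (q * P - Q * p)"
    by (simp add: algebra_simps)
  \<comment> \<open>The exponent comes from the case of equal fractions, where 2m + C + 6 = (m - 1)
    + (m + C + 7); distinct fractions give the stronger exponent m + 6.\<close>
  have "1 \<le> 2 * X ^ (m + C + 7) * D"
  proof (cases "q * P = Q * p")
    case False
    have "2 * real_of_int q * A \<le> X ^ m * A" using q(2) A0 by (intro mult_right_mono) auto
    hence "2 * real_of_int q * A \<le> 1" using Q(2) by (simp add: A_def mult.commute)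
    moreover have "1 \<le> \<bar>real_of_int (q * P - Q * p)\<bar>" using False by linarith
    moreover have "\<bar>real_of_int (q * P - Q * p)\<bar> \<le> \<bar>of_int Q\<bar> * D + real_of_int q * A"
    proof -
      have "real_of_int (q * P - Q * p) = of_int Q * (of_int q * \<xi> - of_int p) - of_int q * (of_int Q * \<xi> - of_int P)"
        using eq by simp
      also have "\<bar>\<dots>\<bar> \<le> \<bar>of_int Q * (of_int q * \<xi> - of_int p)\<bar> + \<bar>of_int q * (of_int Q * \<xi> - of_int P)\<bar>"
        by (rule abs_triangle_ineq4)
      finally show ?thesis using q(1) by (simp add: A_def D_def abs_mult)
    qed
    ultimately have "1 \<le> 2 * (\<bar>of_int Q\<bar> * D)" by linarith
    also have "\<dots> \<le> 2 * (X ^ (m + 6) * D)" using Q(1) D0 by (intro mult_left_mono mult_right_mono) auto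
    also have "\<dots> \<le> 2 * (X ^ (m + C + 7) * D)"
      using X D0 by (intro mult_left_mono mult_right_mono power_increasing) auto
    finally show ?thesis by simp
  next
    case True
    have "Q \<noteq> 0"
    proof
      assume "Q = 0"
      hence "P = 0" using True q(1) by simp
      thus False using Q(3) \<open>Q = 0\<close> by simp
    qed
    have QD: "\<bar>of_int Q\<bar> * D = real_of_int q * A"
    proof -
      have "of_int Q * (of_int q * \<xi> - of_int p) = of_int q * (of_int Q * \<xi> - of_int P)"
        using eq True by simp
      from arg_cong[OF this, of abs] show ?thesis using q(1) by (simp add: A_def D_def abs_mult)
    qed
    have "X ^ (m - 1) \<le> 2 * real_of_int q" by (rule q(3))
    also have "\<dots> \<le> 2 * real_of_int q * (A * X ^ (m + C))"
      using Q(3) q(1) unfolding A_def by (simp add: mult_le_cancel_left1)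
    also have "\<dots> = 2 * (\<bar>of_int Q\<bar> * D) * X ^ (m + C)" using QD by simp
    also have "\<dots> \<le> 2 * (X ^ (m + 6) * D) * X ^ (m + C)"
      using Q(1) D0 X by (intro mult_right_mono mult_left_mono) auto
    also have "\<dots> = X ^ (m - 1) * (2 * X ^ (m + C + 7) * D)"
      using m by (simp add: mult_ac add_ac flip: power_add)
    finally show ?thesis using X by simp
  qed
  also have "\<dots> \<le> 2 * (2 * real_of_int q * X ^ (C + 8)) * D"
    unfolding mC using q(3) X D0 by (intro mult_right_mono mult_left_mono) auto
  finally show ?thesis by (simp add: D_def)
qed

text \<open>What matters is that C does not depend on m. A denominator q is placed between
  consecutive powers m - 1 and m of some X k with q of size at least about X k ^ M, so the loss X k
  ^ (C + 8) is at most a small power of q.\<close>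

lemma irrationality_exponent_eq_2:
  fixes \<xi> :: real and X :: "nat \<Rightarrow> real" and C :: nat
  assumes X: "X 0 \<ge> 2" "\<And>k. X (Suc k) = X k ^ 2"
    and approx: "\<And>m. m \<ge> 1 \<Longrightarrow> \<exists>K. \<forall>k\<ge>K. \<exists>P Q :: int. \<bar>real_of_int Q\<bar> \<le> X k ^ (m + 6) \<and>
      \<bar>of_int Q * \<xi> - of_int P\<bar> * X k ^ m \<le> 1 \<and> 1 \<le> \<bar>of_int Q * \<xi> - of_int P\<bar> * X k ^ (m + C)"
  shows "irrationality_exponent \<xi> = 2"
proof -
  have Xk: "X k \<ge> 2 + real k" for k
  proof (induction k)
    case (Suc k)
    have "2 + real (Suc k) \<le> X k * 2" using Suc by simp
    also have "\<dots> \<le> X k * X k" using Suc by (intro mult_left_mono) auto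
    finally show ?case by (simp add: X(2) power2_eq_square)
  qed (use X(1) in simp)
  have X1: "X k \<ge> 1" for k using Xk[of k] by simp
  have main: "\<exists>q0. \<forall>p q :: int. real_of_int q \<ge> q0 \<longrightarrow> 1 \<le> 4 * real_of_int q * (2 * real_of_int q) powr \<delta> * \<bar>of_int q * \<xi> - of_int p\<bar>"
    if \<delta>: "\<delta> > 0" for \<delta> :: real
  proof -
    \<comment> \<open>With 2q \<ge> X k ^ M, the loss X k ^ (C + 8) is at most (2q) powr ((C + 8) /
      M), and this M makes the exponent at most \<open>\<delta>\<close>.\<close>
    define M where "M = nat \<lceil>real (C + 8) / \<delta>\<rceil> + 1"
    have M: "M \<ge> 1" "real (C + 8) / real M \<le> \<delta>"
    proof -
      have "real (C + 8) / \<delta> \<le> real M" unfolding M_def by linarith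
      moreover show "M \<ge> 1" by (simp add: M_def)
      ultimately show "real (C + 8) / real M \<le> \<delta>" using \<delta> by (simp add: field_simps)
    qed
    have "\<forall>m. \<exists>K. m \<ge> 1 \<longrightarrow> (\<forall>k\<ge>K. \<exists>P Q :: int. \<bar>real_of_int Q\<bar> \<le> X k ^ (m + 6) \<and>
      \<bar>of_int Q * \<xi> - of_int P\<bar> * X k ^ m \<le> 1 \<and> 1 \<le> \<bar>of_int Q * \<xi> - of_int P\<bar> * X k ^ (m + C))"
      using approx by blast
    then obtain K where K: "\<And>m k. m \<ge> 1 \<Longrightarrow> k \<ge> K m \<Longrightarrow> \<exists>P Q :: int. \<bar>real_of_int Q\<bar> \<le> X k ^ (m + 6) \<and>
      \<bar>of_int Q * \<xi> - of_int P\<bar> * X k ^ m \<le> 1 \<and> 1 \<le> \<bar>of_int Q * \<xi> - of_int P\<bar> * X k ^ (m + C)"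
      by metis
    \<comment> \<open>The threshold K depends on m, but only m \<le> 2M occurs; the sum over these
      is a common threshold.\<close>
    define K0 where "K0 = (\<Sum>m\<le>2 * M. K m)"
    have K0: "K m \<le> K0" if "m \<le> 2 * M" for m
      unfolding K0_def using that by (intro member_le_sum) auto
    show ?thesis
    proof (intro exI[of _ "X K0 ^ M"] allI impI)
      fix p q :: int assume q0: "real_of_int q \<ge> X K0 ^ M"
      have "X K0 ^ M \<ge> 1" using X1 by simp
      hence q: "q \<ge> 1" using q0 by linarith
      have "\<exists>k. 2 * real_of_int q < X (Suc k) ^ M \<and> k \<ge> K0"
      proof -
        obtain k :: nat where k: "real k \<ge> 2 * real_of_int q" using real_arch_simple by blast
        have "2 * real_of_int q < X (Suc (K0 + k))" using Xk[of "Suc (K0 + k)"] k by simp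
        also have "\<dots> \<le> X (Suc (K0 + k)) ^ M" using X1 M(1) by (intro self_le_power) auto
        finally show ?thesis by (intro exI[of _ "K0 + k"]) simp
      qed
      \<comment> \<open>Minimality gives X k ^ M \<le> 2q, and for k = K0 the assumed lower bound on
        q takes its place. As X (Suc k) is the square of X k, the value 2q lies below X k ^ (2 *
        M).\<close>
      define k where "k = (LEAST k. 2 * real_of_int q < X (Suc k) ^ M \<and> k \<ge> K0)"
      have k: "2 * real_of_int q < X (Suc k) ^ M" "k \<ge> K0"
        using LeastI_ex[OF \<open>\<exists>k. 2 * real_of_int q < X (Suc k) ^ M \<and> k \<ge> K0\<close>] unfolding k_def by auto
      have Xq: "X k ^ M \<le> 2 * real_of_int q"
      proof (cases "k = K0")
        case True
        thus ?thesis using q0 q by simp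
      next
        case False
        then obtain k' where k': "k = Suc k'" "k' \<ge> K0" using k(2) by (cases k) auto
        show ?thesis
          using not_less_Least[of k' "\<lambda>k. 2 * real_of_int q < X (Suc k) ^ M \<and> k \<ge> K0"] k'
          unfolding k_def[symmetric] by auto
      qed
      have ex: "2 * real_of_int q < X k ^ (2 * M)" using k(1) by (simp add: X(2) power_mult)
      define m where "m = (LEAST m. 2 * real_of_int q < X k ^ m)"
      have m: "2 * real_of_int q < X k ^ m" unfolding m_def by (rule LeastI[of _ "2 * M"]) (rule ex)
      have m2: "m \<le> 2 * M" unfolding m_def by (rule Least_le) (rule ex)
      have "m > 0" using m q by (cases m) auto
      have m3: "X k ^ (m - 1) \<le> 2 * real_of_int q"
        using not_less_Least[of "m - 1" "\<lambda>m. 2 * real_of_int q < X k ^ m"] \<open>m > 0\<close>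
        unfolding m_def[symmetric] by simp
      obtain P Q :: int where PQ: "\<bar>real_of_int Q\<bar> \<le> X k ^ (m + 6)" "\<bar>of_int Q * \<xi> - of_int P\<bar> * X k ^ m \<le> 1"
        "1 \<le> \<bar>of_int Q * \<xi> - of_int P\<bar> * X k ^ (m + C)"
        using K[of m k] K0[OF m2] k(2) \<open>m > 0\<close> by auto
      have d: "1 \<le> 4 * real_of_int q * X k ^ (C + 8) * \<bar>of_int q * \<xi> - of_int p\<bar>"
        using q \<open>m > 0\<close> by (intro distance_to_fraction[OF X1 _ _ m m3 PQ]) auto
      have "X k ^ (C + 8) = (X k ^ M) powr (real (C + 8) / real M)"
        using X1[of k] M(1) by (simp add: powr_powr flip: powr_realpow)
      also have "\<dots> \<le> (2 * real_of_int q) powr (real (C + 8) / real M)"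
        using Xq X1[of k] by (intro powr_mono2) auto
      also have "\<dots> \<le> (2 * real_of_int q) powr \<delta>" using q M(2) by (intro powr_mono) auto
      finally have "4 * real_of_int q * X k ^ (C + 8) * \<bar>of_int q * \<xi> - of_int p\<bar> \<le>
          4 * real_of_int q * (2 * real_of_int q) powr \<delta> * \<bar>of_int q * \<xi> - of_int p\<bar>"
        using q by (intro mult_right_mono mult_left_mono) auto
      thus "1 \<le> 4 * real_of_int q * (2 * real_of_int q) powr \<delta> * \<bar>of_int q * \<xi> - of_int p\<bar>" using d by linarith
    qed
  qed
  define S where "S = {\<mu>::real. infinite {(p :: int, q :: int). q > 0 \<and> coprime p q \<and>
                     \<bar>\<xi> - real_of_int p / real_of_int q\<bar> < real_of_int q powr (- \<mu>)}}"
  have upper: "\<mu> \<le> 2" if "\<mu> \<in> S" for \<mu>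
  proof (rule ccontr)
    assume "\<not> \<mu> \<le> 2"
    \<comment> \<open>Half of the excess over 2 is spent on the lower bound from
      \<open>main\<close>; the other half leaves the decaying factor q powr (-
      \<open>\<delta>\<close>).\<close>
    define \<delta> where "\<delta> = (\<mu> - 2) / 2"
    have \<delta>: "\<delta> > 0" "\<mu> = 2 + 2 * \<delta>" using \<open>\<not> \<mu> \<le> 2\<close> by (simp_all add: \<delta>_def field_simps)
    obtain q0 where q0: "\<And>p q :: int. real_of_int q \<ge> q0 \<Longrightarrow>
        1 \<le> 4 * real_of_int q * (2 * real_of_int q) powr \<delta> * \<bar>of_int q * \<xi> - of_int p\<bar>"
      using main[OF \<delta>(1)] by blast
    define B where "B = max q0 ((4 * 2 powr \<delta>) powr (1 / \<delta>))"
    have bound: "real_of_int q < max 1 B" if pq: "q > 0" "\<bar>\<xi> - real_of_int p / real_of_int q\<bar> < real_of_int q powr (- \<mu>)" for p q :: int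
    proof (rule ccontr)
      assume "\<not> real_of_int q < max 1 B"
      hence qB: "real_of_int q \<ge> q0" "real_of_int q \<ge> (4 * 2 powr \<delta>) powr (1 / \<delta>)" by (auto simp: B_def)
      let ?q = "real_of_int q"
      have q: "?q > 0" using pq(1) by simp
      have "\<bar>?q * \<xi> - of_int p\<bar> = ?q * \<bar>\<xi> - real_of_int p / ?q\<bar>"
        using q by (simp add: abs_mult_pos' field_simps)
      also have "\<dots> < ?q * ?q powr (- \<mu>)" using pq(2) q by (intro mult_strict_left_mono) auto
      finally have "4 * ?q * (2 * ?q) powr \<delta> * \<bar>?q * \<xi> - of_int p\<bar> < 4 * ?q * (2 * ?q) powr \<delta> * (?q * ?q powr (- \<mu>))"
        using q by (intro mult_strict_left_mono) auto
      also have "\<dots> = 4 * 2 powr \<delta> * (?q powr 1 * ?q powr \<delta> * ?q powr 1 * ?q powr (- \<mu>))"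
        using q by (simp add: powr_mult)
      also have "?q powr 1 * ?q powr \<delta> * ?q powr 1 * ?q powr (- \<mu>) = ?q powr (- \<delta>)"
      proof -
        have "1 + \<delta> + 1 + - \<mu> = - \<delta>" by (simp add: \<delta>(2))
        thus ?thesis by (simp only: powr_add[symmetric])
      qed
      also have "4 * 2 powr \<delta> * ?q powr (- \<delta>) \<le> 1"
      proof -
        have "4 * 2 powr \<delta> = ((4 * 2 powr \<delta>) powr (1 / \<delta>)) powr \<delta>" using \<delta>(1) by (simp add: powr_powr)
        also have "\<dots> \<le> ?q powr \<delta>" using qB(2) \<delta>(1) by (intro powr_mono2) auto
        finally show ?thesis using q by (simp add: powr_minus field_simps)
      qed
      finally show False using q0[OF qB(1), of p] by simp
    qed
    define N where "N = \<lceil>max 1 B\<rceil>"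
    define L where "L = \<lceil>(\<bar>\<xi>\<bar> + 1) * real_of_int N\<rceil>"
    have "{(p :: int, q :: int). q > 0 \<and> coprime p q \<and> \<bar>\<xi> - real_of_int p / real_of_int q\<bar> < real_of_int q powr (- \<mu>)}
        \<subseteq> {-L..L} \<times> {0..N}"
    proof safe
      fix p q :: int assume pq: "q > 0" "\<bar>\<xi> - real_of_int p / real_of_int q\<bar> < real_of_int q powr (- \<mu>)"
      have qN: "real_of_int q \<le> real_of_int N" using bound[OF pq] unfolding N_def by linarith
      have "real_of_int q powr (- \<mu>) \<le> real_of_int q powr 0" using pq(1) \<delta> by (intro powr_mono) auto
      hence "\<bar>real_of_int p / real_of_int q\<bar> \<le> \<bar>\<xi>\<bar> + 1" using pq by simp
      hence "\<bar>real_of_int p\<bar> \<le> (\<bar>\<xi>\<bar> + 1) * real_of_int q" using pq(1) by (simp add: abs_divide field_simps)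
      also have "\<dots> \<le> (\<bar>\<xi>\<bar> + 1) * real_of_int N" using qN by (intro mult_left_mono) auto
      finally have "\<bar>real_of_int p\<bar> \<le> real_of_int L" unfolding L_def by linarith
      hence "\<bar>p\<bar> \<le> L" by linarith
      thus "p \<in> {-L..L}" by auto
      show "q \<in> {0..N}" using pq(1) qN by auto
    qed
    hence "finite {(p :: int, q :: int). q > 0 \<and> coprime p q \<and> \<bar>\<xi> - real_of_int p / real_of_int q\<bar> < real_of_int q powr (- \<mu>)}"
      by (rule finite_subset) auto
    thus False using that by (simp add: S_def)
  qed
  have irrational: "\<xi> \<notin> \<rat>"
  proof
    assume "\<xi> \<in> \<rat>"
    then obtain u v :: int where uv: "v > 0" "\<xi> = of_int u / of_int v" by (rule Rats_cases')
    obtain q0 where q0: "\<And>p q :: int. real_of_int q \<ge> q0 \<Longrightarrow>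
        1 \<le> 4 * real_of_int q * (2 * real_of_int q) powr 1 * \<bar>of_int q * \<xi> - of_int p\<bar>"
      using main[of 1] by auto
    \<comment> \<open>The bound \<open>main\<close> also covers fractions that are not reduced, so a
      rational value u / v can be written as nu / nv with denominator beyond q0, where the distance
      is zero.\<close>
    define n where "n = max 1 \<lceil>q0\<rceil>"
    have "real_of_int (n * v) \<ge> q0"
    proof -
      have "q0 \<le> real_of_int n * 1" unfolding n_def by linarith
      also have "\<dots> \<le> real_of_int n * real_of_int v" using uv(1) by (intro mult_left_mono) (auto simp: n_def)
      finally show ?thesis by simp
    qed
    from q0[OF this, of "n * u"] show False using uv by simp
  qed
  \<comment> \<open>Dirichlet's theorem supplies infinitely many approximations at the exponent 2
    itself, so the supremum is attained.\<close>
  hence "infinite (approx_set \<xi>)" using rational_iff_finite_approx_set by blast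
  moreover have "approx_set \<xi> \<subseteq> {(p :: int, q :: int). q > 0 \<and> coprime p q \<and>
      \<bar>\<xi> - real_of_int p / real_of_int q\<bar> < real_of_int q powr (- 2)}"
    by (auto simp: approx_set_def powr_minus powr_numeral divide_inverse)
  ultimately have "2 \<in> S" unfolding S_def using infinite_super by blast
  have "irrationality_exponent \<xi> = Sup (ereal ` S)"
    by (simp add: irrationality_exponent_def S_def)
  also have "\<dots> = 2"
  proof (rule antisym)
    show "Sup (ereal ` S) \<le> 2" by (rule Sup_least) (use upper in auto)
    show "2 \<le> Sup (ereal ` S)" using \<open>2 \<in> S\<close> by (intro Sup_upper) force
  qed
  finally show ?thesis .
qed

section \<open>Values of the series\<close>

lemma fps_conv_radius_linear_growth:
  fixes G :: "real fps"
  assumes "\<And>n. \<bar>fps_nth G n\<bar> \<le> real n + 1"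
  shows "fps_conv_radius G \<ge> 1"
  unfolding fps_conv_radius_def
proof (rule conv_radius_geI_ex')
  fix r :: real assume r: "0 < r" "ereal r < 1"
  have "summable (\<lambda>n. of_nat (Suc n) * r ^ n)"
    using r geometric_deriv_sums[of r] by (auto simp: sums_iff)
  hence "summable (\<lambda>n. fps_nth G n * r ^ n)"
  proof (rule summable_comparison_test')
    fix n
    show "norm (fps_nth G n * r ^ n) \<le> of_nat (Suc n) * r ^ n"
      using assms[of n] r by (simp add: abs_mult mult_right_mono add.commute)
  qed
  thus "summable (\<lambda>n. fps_nth G n * of_real r ^ n)" by simp
qed

lemma eval_fps_sum:
  fixes g :: "'a \<Rightarrow> real fps"
  assumes "finite A" "\<And>i. i \<in> A \<Longrightarrow> fps_conv_radius (g i) \<ge> r" "ereal (norm x) < r"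
  shows "fps_conv_radius (sum g A) \<ge> r \<and> eval_fps (sum g A) x = (\<Sum>i\<in>A. eval_fps (g i) x)"
  using assms(1,2)
proof (induction A rule: finite_induct)
  case (insert a A)
  hence IH: "fps_conv_radius (sum g A) \<ge> r" "eval_fps (sum g A) x = (\<Sum>i\<in>A. eval_fps (g i) x)" by auto
  have "r \<le> min (fps_conv_radius (g a)) (fps_conv_radius (sum g A))" using IH insert.prems by simp
  also have "\<dots> \<le> fps_conv_radius (g a + sum g A)" by (rule fps_conv_radius_add)
  finally show ?case using insert IH assms(3) by (simp add: eval_fps_add less_le_trans)
qed simp

text \<open>Dividing by x^m, with m the order at 0, leaves a function continuous at 0 with non-zero
  value there. This converts orders of vanishing into two-sided sizes at x = 1/X; the lower bound
  also yields non-vanishing.\<close>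

lemma fps_subdegree_bounds:
  fixes G :: "real fps"
  assumes "fps_conv_radius G \<ge> 1" "G \<noteq> 0"
  obtains c C \<delta> where "c > 0" "C > 0" "\<delta> > 0"
    "\<And>x. 0 < x \<Longrightarrow> x < \<delta> \<Longrightarrow> c * x ^ subdegree G \<le> \<bar>eval_fps G x\<bar> \<and> \<bar>eval_fps G x\<bar> \<le> C * x ^ subdegree G"
proof -
  define m where "m = subdegree G"
  define g where "g = \<bar>fps_nth G m\<bar>"
  have g: "g > 0" using assms(2) by (simp add: g_def m_def)
  have r: "fps_conv_radius (fps_shift m G) \<ge> 1" using assms(1) by simp
  have "isCont (eval_fps (fps_shift m G)) 0"
    by (intro continuous_eval_fps less_le_trans[OF _ r]) simp
  hence "eval_fps (fps_shift m G) \<midarrow>0\<rightarrow> fps_nth G m"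
    by (simp add: isCont_def eval_fps_at_0)
  from tendsto_rabs[OF this] have lim: "((\<lambda>x. \<bar>eval_fps (fps_shift m G) x\<bar>) \<longlongrightarrow> g) (at 0)"
    by (simp add: g_def)
  have "eventually (\<lambda>x. \<bar>eval_fps (fps_shift m G) x\<bar> > g / 2 \<and> \<bar>eval_fps (fps_shift m G) x\<bar> < 2 * g) (at 0)"
    using order_tendstoD(1)[OF lim, of "g / 2"] order_tendstoD(2)[OF lim, of "2 * g"] g
    by (intro eventually_conj) auto
  then obtain \<delta> where \<delta>: "\<delta> > 0"
    "\<And>x. x \<noteq> 0 \<Longrightarrow> \<bar>x\<bar> < \<delta> \<Longrightarrow> \<bar>eval_fps (fps_shift m G) x\<bar> > g / 2 \<and> \<bar>eval_fps (fps_shift m G) x\<bar> < 2 * g"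
    unfolding eventually_at by (auto simp: dist_norm)
  show thesis
  proof (rule that[of "g / 2" "2 * g" "min \<delta> 1"])
    fix x :: real assume x: "0 < x" "x < min \<delta> 1"
    have "eval_fps (fps_shift m G) x = eval_fps G x / x ^ m"
      using x less_le_trans[OF _ assms(1), of "ereal x"] by (subst eval_fps_shift) (auto simp: m_def)
    hence "\<bar>eval_fps G x\<bar> = \<bar>eval_fps (fps_shift m G) x\<bar> * x ^ m"
      using x by (simp add: abs_divide)
    thus "g / 2 * x ^ subdegree G \<le> \<bar>eval_fps G x\<bar> \<and> \<bar>eval_fps G x\<bar> \<le> 2 * g * x ^ subdegree G"
      using \<delta>(2)[of x] x unfolding m_def[symmetric] by (auto intro!: mult_right_mono)
  qed (use g \<delta> in auto)
qed

lemma homogenized_value: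
  fixes p :: "int poly" and X :: int
  assumes "X \<ge> 1" "degree p \<le> n"
  obtains z :: int where "of_int z = of_int X ^ n * poly (map_poly of_int p) (1 / of_int X :: real)"
    "\<bar>real_of_int z\<bar> \<le> of_int X ^ n * of_int (\<Sum>i\<le>n. \<bar>coeff p i\<bar>)"
proof
  let ?z = "\<Sum>i\<le>n. coeff p i * X ^ (n - i)"
  have "poly (map_poly of_int p) (1 / of_int X :: real) = (\<Sum>i\<le>n. of_int (coeff p i) * (1 / of_int X) ^ i)"
    unfolding poly_altdef
  proof (intro sum.mono_neutral_cong_left)
    show "{..degree (map_poly of_int p :: real poly)} \<subseteq> {..n}"
      using assms(2) by (auto intro!: order_trans[OF _ degree_le[of n]] simp: coeff_map_poly coeff_eq_0)
  qed (auto simp: coeff_map_poly intro!: le_degree)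
  also have "of_int X ^ n * \<dots> = of_int ?z"
    unfolding sum_distrib_left of_int_sum
  proof (rule sum.cong[OF refl])
    fix i assume "i \<in> {..n}"
    hence "(of_int X :: real) ^ n * (1 / of_int X) ^ i = of_int X ^ (n - i)"
      using assms(1) by (simp add: power_divide power_diff)
    thus "of_int X ^ n * (of_int (coeff p i) * (1 / of_int X) ^ i) = (of_int (coeff p i * X ^ (n - i)) :: real)"
      by (simp add: mult.left_commute)
  qed
  finally show "of_int ?z = of_int X ^ n * poly (map_poly of_int p) (1 / of_int X :: real)" by simp
  have "\<bar>real_of_int ?z\<bar> \<le> (\<Sum>i\<le>n. \<bar>real_of_int (coeff p i * X ^ (n - i))\<bar>)"
    unfolding of_int_sum by (rule sum_abs)
  also have "\<dots> \<le> (\<Sum>i\<le>n. of_int X ^ n * of_int \<bar>coeff p i\<bar>)"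
  proof (rule sum_mono)
    fix i assume "i \<in> {..n}"
    have "(of_int X :: real) ^ (n - i) \<le> of_int X ^ n" using assms(1) by (intro power_increasing) auto
    from mult_left_mono[OF this, of "\<bar>of_int (coeff p i)\<bar>"] show "\<bar>real_of_int (coeff p i * X ^ (n - i))\<bar> \<le> of_int X ^ n * of_int \<bar>coeff p i\<bar>"
      using assms(1) by (simp add: abs_mult mult.commute)
  qed
  finally show "\<bar>real_of_int ?z\<bar> \<le> of_int X ^ n * of_int (\<Sum>i\<le>n. \<bar>coeff p i\<bar>)"
    by (simp add: sum_distrib_left)
qed

context stern_series
begin

definition f :: "real \<Rightarrow> real" where "f = eval_fps (fps_of_ints F)"

lemma F_even: "n > 0 \<Longrightarrow> fps_nth F (2 * n) = (1 - 2 * t) * (fps_nth F n + fps_nth F (n - 1))"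
  and F_odd: "fps_nth F (2 * n + 1) = (1 - 2 * t) * fps_nth F n"
proof -
  have "F = fps_const (2 * t) + fps_const (1 - 2 * t) * ((F oo fps_X\<^sup>2) + fps_X * (F oo fps_X\<^sup>2) + fps_X * (fps_X * (F oo fps_X\<^sup>2)))"
    using F_rec by (simp add: algebra_simps power2_eq_square)
  hence *: "fps_nth F m = fps_nth (fps_const (2 * t) + fps_const (1 - 2 * t) * ((F oo fps_X\<^sup>2) + fps_X * (F oo fps_X\<^sup>2) + fps_X * (fps_X * (F oo fps_X\<^sup>2)))) m" for m
    by (rule arg_cong)
  show "fps_nth F (2 * n) = (1 - 2 * t) * (fps_nth F n + fps_nth F (n - 1))" if "n > 0"
  proof (cases n)
    case (Suc m)
    show ?thesis unfolding Suc by (subst *) (simp add: fps_nth_compose_X_power)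
  qed (use that in simp)
  show "fps_nth F (2 * n + 1) = (1 - 2 * t) * fps_nth F n"
    by (subst *) (simp add: fps_nth_compose_X_power)
qed

lemma F_growth: "\<bar>fps_nth F n\<bar> \<le> int n + 1"
proof (induction n rule: less_induct)
  case (less n)
  have s: "\<bar>1 - 2 * t\<bar> = 1" using t by auto
  consider "n = 0" | m where "n = 2 * m" "m > 0" | m where "n = 2 * m + 1"
    by (metis evenE gr0I mult_0_right oddE)
  thus ?case
  proof cases
    case 1
    thus ?thesis by (simp add: F_0)
  next
    case (2 m)
    have "\<bar>fps_nth F n\<bar> \<le> \<bar>fps_nth F m\<bar> + \<bar>fps_nth F (m - 1)\<bar>"
      unfolding 2(1) F_even[OF 2(2)] abs_mult s by simp
    also have "\<dots> \<le> (int m + 1) + (int (m - 1) + 1)" using 2 by (intro add_mono less) auto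
    finally show ?thesis using 2 by simp
  next
    case (3 m)
    have "\<bar>fps_nth F n\<bar> = \<bar>fps_nth F m\<bar>" unfolding 3 F_odd abs_mult s by simp
    also have "\<dots> \<le> int m + 1" using 3 by (intro less) auto
    finally show ?thesis using 3 by simp
  qed
qed

lemma conv_radius_F: "fps_conv_radius (fps_of_ints F :: real fps) \<ge> 1"
proof (rule fps_conv_radius_linear_growth)
  fix n
  have "\<bar>real_of_int (fps_nth F n)\<bar> \<le> real_of_int (int n + 1)"
    using F_growth[of n] by (metis of_int_abs of_int_le_iff)
  thus "\<bar>fps_nth (fps_of_ints F :: real fps) n\<bar> \<le> real n + 1" by simp
qed

lemma f_rec:
  assumes "\<bar>x\<bar> < 1"
  shows "f x = 2 * of_int t + (1 - 2 * of_int t) * (1 + x + x\<^sup>2) * f (x\<^sup>2)"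
proof -
  let ?F = "fps_of_ints F :: real fps"
  define H where "H = ?F oo fps_X\<^sup>2"
  have rc: "fps_conv_radius H \<ge> 1"
  proof (rule fps_conv_radius_linear_growth)
    fix n
    have "\<bar>real_of_int (fps_nth F (n div 2))\<bar> \<le> real_of_int (int (n div 2) + 1)"
      using F_growth[of "n div 2"] by (metis of_int_abs of_int_le_iff)
    also have "\<dots> \<le> real n + 1" by simp
    finally show "\<bar>fps_nth H n\<bar> \<le> real n + 1" by (simp add: H_def fps_nth_compose_X_power)
  qed
  have "(\<lambda>n. fps_nth ?F n * (x\<^sup>2) ^ n) sums eval_fps ?F (x\<^sup>2)"
  proof (rule sums_eval_fps)
    have "norm (x\<^sup>2) < 1" using assms by (simp add: abs_square_less_1)
    thus "ereal (norm (x\<^sup>2)) < fps_conv_radius ?F" by (intro less_le_trans[OF _ conv_radius_F]) simp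
  qed
  hence "(\<lambda>n. fps_nth H (2 * n) * x ^ (2 * n)) sums f (x\<^sup>2)"
    by (simp add: f_def H_def fps_nth_compose_X_power power_mult)
  hence "(\<lambda>n. fps_nth H n * x ^ n) sums f (x\<^sup>2)"
    by (subst (asm) sums_mono_reindex[of "\<lambda>n. 2 * n"])
      (auto simp: strict_mono_def H_def fps_nth_compose_X_power elim!: evenE)
  hence comp: "eval_fps H x = f (x\<^sup>2)"
    by (simp add: eval_fps_def sums_iff)
  \<comment> \<open>Writing the factor as the series of a polynomial makes its radius of convergence
    infinite and its evaluation a polynomial value.\<close>
  have h: "fps_of_poly ([:1 - 2 * of_int t:] * [:1, 1, 1 :: real:]) = fps_const (1 - 2 * of_int t) * (1 + fps_X + fps_X\<^sup>2)"
    by (simp only: fps_of_poly_mult fps_of_poly_const fps_of_poly_quad[unfolded quad_def])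
  have "?F = fps_of_poly [:2 * of_int t:] + fps_of_poly ([:1 - 2 * of_int t:] * [:1, 1, 1:]) * H"
    using arg_cong[OF F_rec, of "fps_of_ints :: int fps \<Rightarrow> real fps"]
    unfolding h by (simp add: H_def fps_of_poly_const)
  hence "f x = eval_fps (fps_of_poly [:2 * of_int t:] + fps_of_poly ([:1 - 2 * of_int t:] * [:1, 1, 1:]) * H) x"
    by (simp add: f_def)
  also have "\<dots> = 2 * of_int t + (1 - 2 * of_int t) * (1 + x + x\<^sup>2) * f (x\<^sup>2)"
  proof -
    have n1: "ereal (norm x) < 1" using assms by simp
    hence n: "ereal (norm x) < fps_conv_radius H" using rc less_le_trans by blast
    have "1 \<le> min (fps_conv_radius (fps_of_poly ([:1 - 2 * of_int t:] * [:1, 1, 1:]) :: real fps)) (fps_conv_radius H)"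
      using rc by simp
    also have "\<dots> \<le> fps_conv_radius (fps_of_poly ([:1 - 2 * of_int t:] * [:1, 1, 1:]) * H)"
      by (rule fps_conv_radius_mult)
    finally show ?thesis using n n1 less_le_trans[OF n1]
      by (simp add: eval_fps_add eval_fps_mult comp power2_eq_square algebra_simps)
  qed
  finally show ?thesis .
qed

lemma eval_polynomial_in_F:
  fixes P :: "nat \<Rightarrow> int poly" and N :: nat
  defines "G \<equiv> fps_of_ints (\<Sum>i\<le>N. fps_of_poly (P i) * F ^ i) :: real fps"
  shows "fps_conv_radius G \<ge> 1"
    and "\<bar>x\<bar> < 1 \<Longrightarrow> eval_fps G x = (\<Sum>i\<le>N. poly (map_poly of_int (P i)) x * f x ^ i)"
proof -
  define g where "g i = fps_of_poly (map_poly of_int (P i)) * (fps_of_ints F :: real fps) ^ i" for i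
  have G: "G = (\<Sum>i\<le>N. g i)" by (simp add: G_def g_def)
  have rp: "fps_conv_radius ((fps_of_ints F :: real fps) ^ i) \<ge> 1" for i
    using conv_radius_F fps_conv_radius_power order_trans by blast
  have rg: "fps_conv_radius (g i) \<ge> 1" for i
  proof -
    have "1 \<le> min (fps_conv_radius (fps_of_poly (map_poly of_int (P i)) :: real fps)) (fps_conv_radius ((fps_of_ints F :: real fps) ^ i))"
      using rp[of i] by simp
    also have "\<dots> \<le> fps_conv_radius (g i)" unfolding g_def by (rule fps_conv_radius_mult)
    finally show ?thesis .
  qed
  show "fps_conv_radius G \<ge> 1"
    unfolding G using eval_fps_sum[of "{..N}" 1 g 0] rg by simp
  assume x: "\<bar>x\<bar> < 1"
  have "eval_fps (g i) x = poly (map_poly of_int (P i)) x * f x ^ i" for i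
  proof -
    have n1: "ereal (norm x) < 1" using x by simp
    show ?thesis unfolding g_def f_def
      using less_le_trans[OF n1 rp[of i]] less_le_trans[OF n1 conv_radius_F]
      by (simp add: eval_fps_mult eval_fps_power)
  qed
  thus "eval_fps G x = (\<Sum>i\<le>N. poly (map_poly of_int (P i)) x * f x ^ i)"
    unfolding G using eval_fps_sum[of "{..N}" 1 g x] rg x by simp
qed

text \<open>$U = X^2 \prod_{j<k} (1 + z^{2^j} + z^{2^{j+1}})$ at $z = 1/b$, where $X = b^{2^k}$; the numbers
  $\sigma$ and $W$ collect the sign and the inhomogeneous part of the iterated equation.\<close>
lemma iterated_equation:
  fixes b :: nat
  assumes "b \<ge> 2"
  defines "X \<equiv> \<lambda>k. int b ^ 2 ^ k"
  obtains \<sigma> U W :: int where "\<bar>\<sigma>\<bar> = 1" "X k ^ 2 \<le> U" "U \<le> X k ^ 3" "\<bar>W\<bar> \<le> X k ^ 3"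
    "of_int U * f (1 / of_int (X k)) = of_int (\<sigma> * X k ^ 2) * f (1 / b) - of_int W"
proof -
  have X1: "X k \<ge> 2" for k
  proof -
    have "int b ^ 1 \<le> X k" unfolding X_def using assms(1) by (intro power_increasing) auto
    thus ?thesis using assms(1) by simp
  qed
  have XS: "X (Suc k) = X k ^ 2" for k by (simp add: X_def mult.commute flip: power_mult)
  have s: "\<bar>1 - 2 * t\<bar> = 1" "(1 - 2 * t) * (1 - 2 * t) = 1" "0 \<le> t" "t \<le> 1" using t by auto
  \<comment> \<open>Starting with U = b^2 makes the common denominator exactly X k ^ 2 at every
    level. The bound 3^k - 1 for W is the one that reproduces itself: (3^k - 1) + 2 * 3^k = 3^(k+1)
    - 1.\<close>
  have "\<exists>\<sigma> U W. \<bar>\<sigma>\<bar> = 1 \<and> X k ^ 2 \<le> U \<and> U \<le> 3 ^ k * X k ^ 2 \<and> \<bar>W\<bar> \<le> (3 ^ k - 1) * X k ^ 2 \<and>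
    of_int U * f (1 / of_int (X k)) = of_int (\<sigma> * X k ^ 2) * f (1 / b) - of_int W" for k
  proof (induction k)
    case 0
    show ?case by (intro exI[of _ 1] exI[of _ "int b ^ 2"] exI[of _ 0]) (simp add: X_def)
  next
    case (Suc k)
    then obtain \<sigma> U W where IH: "\<bar>\<sigma>\<bar> = 1" "X k ^ 2 \<le> U" "U \<le> 3 ^ k * X k ^ 2" "\<bar>W\<bar> \<le> (3 ^ k - 1) * X k ^ 2"
      "of_int U * f (1 / of_int (X k)) = of_int (\<sigma> * X k ^ 2) * f (1 / b) - of_int W" by blast
    define Y where "Y = X k"
    have Y: "Y \<ge> 2" using X1 by (simp add: Y_def)
    note IH = IH[folded Y_def]
    define U' where "U' = U * (Y\<^sup>2 + Y + 1)"
    define W' where "W' = (1 - 2 * t) * Y\<^sup>2 * (W + 2 * t * U)"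
    have q: "Y\<^sup>2 \<le> Y\<^sup>2 + Y + 1" "Y\<^sup>2 + Y + 1 \<le> 3 * Y\<^sup>2"
      using Y self_le_power[of Y 2] by auto
    have U0: "0 \<le> U" using IH(2) by (rule order_trans[rotated]) simp
    have "Y\<^sup>2 * Y\<^sup>2 \<le> U'" unfolding U'_def using IH(2) q(1) U0 by (intro mult_mono) auto
    moreover have "U' \<le> (3 ^ k * Y\<^sup>2) * (3 * Y\<^sup>2)" unfolding U'_def using IH(3) q Y by (intro mult_mono) auto
    moreover have "\<bar>W'\<bar> \<le> (3 ^ Suc k - 1) * (Y\<^sup>2 * Y\<^sup>2)"
    proof -
      have tU: "\<bar>2 * t * U\<bar> \<le> 2 * U" using t U0 by auto
      have "\<bar>W'\<bar> = Y\<^sup>2 * \<bar>W + 2 * t * U\<bar>" unfolding W'_def abs_mult s by simp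
      also have "\<dots> \<le> Y\<^sup>2 * ((3 ^ k - 1) * Y\<^sup>2 + 2 * (3 ^ k * Y\<^sup>2))"
        using IH(3,4) tU by (intro mult_left_mono) auto
      also have "\<dots> = (3 ^ Suc k - 1) * (Y\<^sup>2 * Y\<^sup>2)" by (simp add: algebra_simps)
      finally show ?thesis .
    qed
    moreover have "of_int U' * f (1 / of_int (Y\<^sup>2)) = of_int ((1 - 2 * t) * \<sigma> * (Y\<^sup>2 * Y\<^sup>2)) * f (1 / b) - of_int W'"
    proof -
      let ?y = "1 / of_int Y :: real"
      define g where "g = (1 + ?y + ?y\<^sup>2) * f (?y\<^sup>2)"
      have fy: "f ?y = 2 * of_int t + (1 - 2 * of_int t) * g"
        unfolding g_def mult.assoc[symmetric] using Y by (intro f_rec) auto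
      have sr: "(1 - 2 * real_of_int t) * (1 - 2 * real_of_int t) = 1" using t by auto
      have "(1 + ?y + ?y\<^sup>2) * of_int (Y\<^sup>2) = of_int (Y\<^sup>2 + Y + 1)"
        using Y by (simp add: field_simps power2_eq_square)
      hence "real_of_int U' = of_int U * ((1 + ?y + ?y\<^sup>2) * of_int (Y\<^sup>2))"
        by (simp only: U'_def of_int_mult)
      hence "of_int U' * f (?y\<^sup>2) = of_int U * of_int (Y\<^sup>2) * g"
        unfolding g_def by (simp only: mult_ac)
      \<comment> \<open>The sign 1 - 2t is its own inverse; inserting its square prepares the
        expression for the substitution of f at 1/Y.\<close>
      also have "\<dots> = (1 - 2 * of_int t) * of_int (Y\<^sup>2) * of_int U * ((1 - 2 * of_int t) * g)"
        using sr by (simp add: mult.assoc mult.left_commute)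
      also have "\<dots> = (1 - 2 * of_int t) * of_int (Y\<^sup>2) * (of_int U * f ?y - 2 * of_int t * of_int U)"
        by (subst fy) (simp add: algebra_simps)
      also have "\<dots> = of_int ((1 - 2 * t) * \<sigma> * (Y\<^sup>2 * Y\<^sup>2)) * f (1 / b) - of_int W'"
        unfolding IH(5) by (simp add: W'_def algebra_simps)
      finally show ?thesis by (simp add: power_divide)
    qed
    moreover have "\<bar>(1 - 2 * t) * \<sigma>\<bar> = 1" by (simp add: abs_mult s IH(1))
    ultimately show ?case
      unfolding XS Y_def[symmetric]
      by (intro exI[of _ "(1 - 2 * t) * \<sigma>"] exI[of _ U'] exI[of _ W'])
        (simp add: power2_eq_square[of "Y\<^sup>2"] mult_ac)
  qed
  then obtain \<sigma> U W where *: "\<bar>\<sigma>\<bar> = 1" "X k ^ 2 \<le> U" "U \<le> 3 ^ k * X k ^ 2" "\<bar>W\<bar> \<le> (3 ^ k - 1) * X k ^ 2"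
    "of_int U * f (1 / of_int (X k)) = of_int (\<sigma> * X k ^ 2) * f (1 / b) - of_int W" by blast
  \<comment> \<open>This trades the factor 3^k for one more power of X. The step from k = 0 is
    separate because 3 \<le> 3^k fails there.\<close>
  have X3: "3 ^ k \<le> X k"
  proof (induction k)
    case (Suc k)
    show ?case
    proof (cases "k = 0")
      case True
      have "(3::int) \<le> 2 ^ 2" by simp
      also have "\<dots> \<le> int b ^ 2" using assms(1) by (intro power_mono) auto
      finally show ?thesis by (simp add: True X_def)
    next
      case False
      have "(3::int) ^ 1 \<le> 3 ^ k" using False by (intro power_increasing) auto
      hence "(3::int) ^ Suc k \<le> X k * X k" using Suc by (simp add: mult_mono)
      thus ?thesis by (simp add: XS power2_eq_square)
    qed
  qed (use X1[of 0] in simp)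
  have "U \<le> X k ^ 3" "\<bar>W\<bar> \<le> X k ^ 3"
  proof -
    have "3 ^ k * X k ^ 2 \<le> X k * X k ^ 2" using X3 by (intro mult_right_mono) auto
    moreover have "(3 ^ k - 1) * X k ^ 2 \<le> 3 ^ k * X k ^ 2" by (intro mult_right_mono) auto
    ultimately show "U \<le> X k ^ 3" "\<bar>W\<bar> \<le> X k ^ 3" using *(3,4) by (simp_all add: power3_eq_cube power2_eq_square)
  qed
  thus thesis using that * by blast
qed

end

section \<open>Rational approximations to the value at 1/b and its irrationality exponent\<close>

lemma eventually_ge_power_tower:
  fixes B :: real and b :: nat
  assumes "b \<ge> 2"
  obtains K where "\<And>k. k \<ge> K \<Longrightarrow> B \<le> real b ^ 2 ^ k"
proof -
  obtain K :: nat where K: "B \<le> real K" using real_arch_simple by blast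
  have "B \<le> real b ^ 2 ^ k" if "k \<ge> K" for k
  proof -
    have "B \<le> real k" using K that by linarith
    also have "k \<le> 2 ^ 2 ^ k"
      by (metis less_exp less_le_trans less_imp_le)
    hence "real k \<le> real (2 ^ 2 ^ k)" by (rule of_nat_mono)
    also have "\<dots> = 2 ^ 2 ^ k" by simp
    also have "(2::real) ^ 2 ^ k \<le> real b ^ 2 ^ k" using assms by (intro power_mono) auto
    finally show ?thesis .
  qed
  thus thesis by (rule that)
qed

context stern_series
begin

text \<open>With n = m + 3 and each constant absorbed by one factor X, the exponents are as follows.
  The denominator costs n for clearing q, 1 for its coefficients and 2 for X^2, that is m + 6. The
  upper estimate is 3 + n + 1 - (2n + 1) = -m, from U \<le> X^3. The lower one is 2 + n - 1 - (2n +
  6) = -(m + 8), from U \<ge> X^2.\<close>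

lemma rational_approximations:
  fixes b :: nat
  assumes "b \<ge> 2"
  shows "\<exists>K. \<forall>k\<ge>K. \<exists>P Q :: int. \<bar>real_of_int Q\<bar> \<le> (real b ^ 2 ^ k) ^ (m + 6) \<and>
      \<bar>of_int Q * f (1 / b) - of_int P\<bar> * (real b ^ 2 ^ k) ^ m \<le> 1 \<and>
      1 \<le> \<bar>of_int Q * f (1 / b) - of_int P\<bar> * (real b ^ 2 ^ k) ^ (m + 8)"
proof -
  define n where "n = m + 3"
  obtain p q where pq: "q \<noteq> 0" "degree p \<le> n" "degree q \<le> n"
    "\<And>j. j \<le> 2 * n \<Longrightarrow> fps_nth (fps_of_poly q * F - fps_of_poly p) j = 0"
    using pade_approximant by metis
  \<comment> \<open>The linear form is written as a polynomial of degree 1 in F so that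
    \<open>eval_polynomial_in_F\<close> applies to it.\<close>
  define P where "P = (\<lambda>i::nat. if i = 0 then - p else q)"
  define E where "E = (\<Sum>i\<le>1. fps_of_poly (P i) * F ^ i)"
  have E: "E = fps_of_poly q * F - fps_of_poly p" by (simp add: E_def P_def fps_of_poly_uminus)
  define G :: "real fps" where "G = fps_of_ints E"
  obtain j where j: "j < 2 * n + 7" "fps_nth E j \<noteq> 0"
    using linear_form_nonzero_coeff[of p q n] pq unfolding E by auto
  have Gj: "fps_nth G j \<noteq> 0" using j by (simp add: G_def)
  hence G0: "G \<noteq> 0" by auto
  define M where "M = subdegree G"
  have M: "2 * n + 1 \<le> M" "M \<le> 2 * n + 6"
  proof -
    have "fps_nth G i = 0" if "i < 2 * n + 1" for i
      using pq(4)[of i] that unfolding E[symmetric] by (simp add: G_def)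
    thus "2 * n + 1 \<le> M" unfolding M_def by (intro subdegree_geI[OF G0]) auto
    show "M \<le> 2 * n + 6" unfolding M_def using subdegree_leI[OF Gj] j(1) by linarith
  qed
  have rG: "fps_conv_radius G \<ge> 1" unfolding G_def E_def by (rule eval_polynomial_in_F)
  obtain c C \<delta> where c: "c > 0" "C > 0" "\<delta> > 0"
    "\<And>x. 0 < x \<Longrightarrow> x < \<delta> \<Longrightarrow> c * x ^ M \<le> \<bar>eval_fps G x\<bar> \<and> \<bar>eval_fps G x\<bar> \<le> C * x ^ M"
    using fps_subdegree_bounds[OF rG G0] unfolding M_def by metis
  define L where "L = real_of_int (\<Sum>i\<le>n. \<bar>coeff q i\<bar>)"
  \<comment> \<open>The polynomials p and q are fixed before k, so X eventually exceeds L, C and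
    1/c; the entry 1/\<open>\<delta>\<close> + 1 gives X > 1 and puts 1/X within the range of the
    estimates.\<close>
  obtain K where K: "\<And>k. k \<ge> K \<Longrightarrow> max (max L C) (max (1 / c) (1 / \<delta> + 1)) \<le> real b ^ 2 ^ k"
    using eventually_ge_power_tower[OF assms] by metis
  show ?thesis
  proof (intro exI[of _ K] allI impI)
    fix k assume k: "k \<ge> K"
    define Y where "Y = int b ^ 2 ^ k"
    define X where "X = real_of_int Y"
    have XY: "real b ^ 2 ^ k = X" by (simp add: X_def Y_def)
    have X: "L \<le> X" "C \<le> X" "1 / c \<le> X" "1 / \<delta> + 1 \<le> X" using K[OF k] unfolding XY by auto
    have "1 / \<delta> > 0" using c(3) by simp
    hence "X > 1" using X(4) by linarith
    hence X1: "X > 1" "Y \<ge> 1" by (simp_all add: X_def)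
    have X\<delta>: "0 < 1 / X" "1 / X < \<delta>" "\<bar>1 / X\<bar> < 1"
    proof -
      have "1 / \<delta> < X" using X(4) by linarith
      thus "1 / X < \<delta>" using c(3) X1 by (simp add: field_simps)
    qed (use X1 in auto)
    obtain \<sigma> U W :: int where it: "\<bar>\<sigma>\<bar> = 1" "Y ^ 2 \<le> U" "U \<le> Y ^ 3" "\<bar>W\<bar> \<le> Y ^ 3"
      "of_int U * f (1 / X) = of_int (\<sigma> * Y ^ 2) * f (1 / b) - of_int W"
      using iterated_equation[OF assms, of k] unfolding X_def Y_def by metis
    obtain zq where zq: "real_of_int zq = X ^ n * poly (map_poly of_int q) (1 / X)" "\<bar>real_of_int zq\<bar> \<le> X ^ n * L"
      using homogenized_value[OF X1(2) pq(3)] unfolding X_def L_def by metis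
    obtain zp where zp: "real_of_int zp = X ^ n * poly (map_poly of_int p) (1 / X)"
      using homogenized_value[OF X1(2) pq(2)] unfolding X_def by metis
    have UX: "X ^ 2 \<le> of_int U" "of_int U \<le> X ^ 3"
      using it(2,3) unfolding X_def by (metis of_int_le_iff of_int_power)+
    \<comment> \<open>Multiplying zq f(1/X) - zp by U and replacing U f(1/X) through the iterated
      equation gives an integer linear form in f(1/b) with these coefficients.\<close>
    define Q where "Q = zq * (\<sigma> * Y ^ 2)"
    define R where "R = zq * W + U * zp"
    define A where "A = \<bar>of_int Q * f (1 / b) - real_of_int R\<bar>"
    have mneg: "map_poly of_int (- p) = - (map_poly of_int p :: real poly)"
      by (rule poly_eqI) (simp add: coeff_map_poly)
    have ev: "eval_fps G (1 / X) = poly (map_poly of_int q) (1 / X) * f (1 / X) - poly (map_poly of_int p) (1 / X)"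
      unfolding G_def E_def eval_polynomial_in_F(2)[OF X\<delta>(3)] by (simp add: P_def mneg)
    have "of_int Q * f (1 / b) - real_of_int R = of_int zq * (of_int (\<sigma> * Y ^ 2) * f (1 / b) - of_int W) - of_int U * of_int zp"
      by (simp add: Q_def R_def algebra_simps)
    also have "\<dots> = of_int U * (of_int zq * f (1 / X) - of_int zp)"
      unfolding it(5)[symmetric] by (simp add: algebra_simps)
    also have "\<dots> = of_int U * X ^ n * eval_fps G (1 / X)"
      by (simp add: zq zp ev algebra_simps)
    finally have A: "A = of_int U * X ^ n * \<bar>eval_fps G (1 / X)\<bar>"
      using UX X1 order_trans[OF zero_le_power2 UX(1)] by (simp add: A_def abs_mult)
    have G1: "c * (1 / X) ^ M \<le> \<bar>eval_fps G (1 / X)\<bar>" "\<bar>eval_fps G (1 / X)\<bar> \<le> C * (1 / X) ^ M"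
      using c(4)[OF X\<delta>(1,2)] by auto
    have inv: "(1 / X) ^ e * X ^ e = 1" for e using X1 by (simp add: power_divide)
    have "\<bar>real_of_int Q\<bar> = \<bar>real_of_int zq\<bar> * X ^ 2"
      using it(1) by (simp add: Q_def X_def abs_mult flip: of_int_abs)
    also have "\<dots> \<le> X ^ n * X * X ^ 2"
      using zq(2) X(1) X1 by (intro mult_right_mono) (auto intro: order_trans mult_left_mono)
    also have "\<dots> = X ^ (m + 6)" by (simp add: n_def add.commute flip: power_add power_Suc2)
    finally have Q: "\<bar>real_of_int Q\<bar> \<le> X ^ (m + 6)" .
    have "A \<le> X ^ 3 * X ^ n * (C * (1 / X) ^ M)"
      unfolding A using UX(2) G1(2) X1 by (intro mult_mono) auto
    also have "\<dots> \<le> X ^ 3 * X ^ n * (X * (1 / X) ^ (2 * n + 1))"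
      using X(2) X1 c(2) M(1) by (intro mult_left_mono mult_mono power_decreasing) auto
    finally have "A * X ^ m \<le> X ^ 3 * X ^ n * (X * (1 / X) ^ (2 * n + 1)) * X ^ m"
      using X1 by (intro mult_right_mono) auto
    also have "\<dots> = (1 / X) ^ (2 * n + 1) * X ^ (2 * n + 1)"
    proof -
      have "2 * n + 1 = 3 + n + 1 + m" by (simp add: n_def)
      hence "X ^ (2 * n + 1) = X ^ 3 * X ^ n * X * X ^ m" by (simp only: power_add power_one_right)
      thus ?thesis by (simp only: mult_ac)
    qed
    finally have up: "A * X ^ m \<le> 1" unfolding inv .
    have "X ^ 2 * X ^ n * (1 / X * (1 / X) ^ (2 * n + 6)) \<le> X ^ 2 * X ^ n * (c * (1 / X) ^ M)"
    proof (intro mult_left_mono mult_mono power_decreasing)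
      show "1 / X \<le> c" using X(3) X1 c(1) by (simp add: field_simps)
    qed (use X1 c M in auto)
    also have "\<dots> \<le> A" unfolding A using UX(1) order_trans[OF zero_le_power2 UX(1)] G1(1) X1 c
      by (intro mult_mono mult_nonneg_nonneg) auto
    finally have "X ^ 2 * X ^ n * (1 / X * (1 / X) ^ (2 * n + 6)) * X ^ (m + 8) \<le> A * X ^ (m + 8)"
      using X1 by (intro mult_right_mono) auto
    moreover have "X ^ 2 * X ^ n * (1 / X * (1 / X) ^ (2 * n + 6)) * X ^ (m + 8) = (1 / X) ^ (2 * n + 7) * X ^ (2 * n + 7)"
    proof -
      have "2 * n + 7 = 2 + n + (m + 8)" by (simp add: n_def)
      hence "X ^ (2 * n + 7) = X ^ 2 * X ^ n * X ^ (m + 8)" by (simp only: power_add)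
      moreover have "2 * n + 7 = Suc (2 * n + 6)" by simp
      hence "(1 / X) ^ (2 * n + 7) = 1 / X * (1 / X) ^ (2 * n + 6)" by (simp only: power_Suc)
      ultimately show ?thesis by (simp only: mult_ac)
    qed
    ultimately have "1 \<le> A * X ^ (m + 8)" unfolding inv by simp
    thus "\<exists>P Q :: int. \<bar>real_of_int Q\<bar> \<le> (real b ^ 2 ^ k) ^ (m + 6) \<and>
      \<bar>of_int Q * f (1 / b) - of_int P\<bar> * (real b ^ 2 ^ k) ^ m \<le> 1 \<and>
      1 \<le> \<bar>of_int Q * f (1 / b) - of_int P\<bar> * (real b ^ 2 ^ k) ^ (m + 8)"
      unfolding XY using Q up by (intro exI[of _ R] exI[of _ Q]) (simp add: A_def)
  qed
qed

lemma irrationality_exponent_f: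
  fixes b :: nat
  assumes "b \<ge> 2"
  shows "irrationality_exponent (f (1 / b)) = 2"
proof (rule irrationality_exponent_eq_2[where X = "\<lambda>k. real b ^ 2 ^ k" and C = 8])
  show "real b ^ 2 ^ 0 \<ge> 2" using assms by simp
  show "real b ^ 2 ^ Suc k = (real b ^ 2 ^ k)\<^sup>2" for k by (simp add: mult.commute flip: power_mult)
  show "\<exists>K. \<forall>k\<ge>K. \<exists>P Q :: int. \<bar>real_of_int Q\<bar> \<le> (real b ^ 2 ^ k) ^ (m + 6) \<and>
      \<bar>of_int Q * f (1 / b) - of_int P\<bar> * (real b ^ 2 ^ k) ^ m \<le> 1 \<and>
      1 \<le> \<bar>of_int Q * f (1 / b) - of_int P\<bar> * (real b ^ 2 ^ k) ^ (m + 8)" for m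
    by (rule rational_approximations[OF assms])
qed

section \<open>Mahler's method for the value at 1/b\<close>

text \<open>Each term has total degree (i - j) + (N - i) + j = N in W, U and s, all of size at most
  X^3, whence X^(3N); the factor 2^N bounds the binomial coefficients and N + 1 counts the
  terms.\<close>

lemma bounded_power_combination:
  fixes X L :: real and z :: "nat \<Rightarrow> int" and U W s :: int
  assumes X: "X \<ge> 1" and z: "\<And>i. i \<le> N \<Longrightarrow> \<bar>real_of_int (z i)\<bar> \<le> L" and L: "L \<ge> 0"
    and U: "\<bar>real_of_int U\<bar> \<le> X ^ 3" and W: "\<bar>real_of_int W\<bar> \<le> X ^ 3" and s: "\<bar>real_of_int s\<bar> \<le> X ^ 3"
  shows "\<exists>g :: nat \<Rightarrow> int. (\<forall>y::real. (\<Sum>i\<le>N. of_int (z i) * of_int U ^ (N - i) * (of_int s * y - of_int W) ^ i) = (\<Sum>j\<le>N. of_int (g j) * y ^ j)) \<and>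
    (\<forall>j\<le>N. \<bar>real_of_int (g j)\<bar> \<le> real (N + 1) * 2 ^ N * L * X ^ (3 * N))"
proof (intro exI conjI allI impI)
  let ?g = "\<lambda>j. (\<Sum>i\<le>N. of_nat (i choose j) * (- W) ^ (i - j) * (z i * U ^ (N - i))) * s ^ j"
  show "(\<Sum>i\<le>N. of_int (z i) * of_int U ^ (N - i) * (of_int s * y - of_int W) ^ i) = (\<Sum>j\<le>N. of_int (?g j) * y ^ j)" for y :: real
    unfolding sum_binomial_shift by (simp add: power_mult_distrib mult.assoc)
  fix j assume j: "j \<le> N"
  have "\<bar>real_of_int (?g j)\<bar> = \<bar>\<Sum>i\<le>N. real (i choose j) * (- of_int W) ^ (i - j) * (of_int (z i) * of_int U ^ (N - i)) * of_int s ^ j\<bar>"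
    by (simp add: sum_distrib_right)
  also have "\<dots> \<le> (\<Sum>i\<le>N. \<bar>real (i choose j) * (- of_int W) ^ (i - j) * (of_int (z i) * of_int U ^ (N - i)) * of_int s ^ j\<bar>)"
    by (rule sum_abs)
  also have "\<dots> \<le> (\<Sum>i\<le>N. 2 ^ N * L * X ^ (3 * N))"
  proof (rule sum_mono)
    fix i assume i: "i \<in> {..N}"
    show "\<bar>real (i choose j) * (- of_int W) ^ (i - j) * (of_int (z i) * of_int U ^ (N - i)) * of_int s ^ j\<bar> \<le> 2 ^ N * L * X ^ (3 * N)"
    proof (cases "j \<le> i")
      case False
      thus ?thesis using L X by (simp add: binomial_eq_0)
    next
      case True
      have "i choose j \<le> (\<Sum>k\<le>i. i choose k)" using True by (intro member_le_sum) auto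
      also have "\<dots> = 2 ^ i" by (rule choose_row_sum)
      also have "\<dots> \<le> 2 ^ N" using i by (intro power_increasing) auto
      finally have ch: "real (i choose j) \<le> 2 ^ N" by (metis of_nat_le_iff of_nat_numeral of_nat_power)
      have "\<bar>real (i choose j) * (- of_int W) ^ (i - j) * (of_int (z i) * of_int U ^ (N - i)) * of_int s ^ j\<bar> =
        real (i choose j) * \<bar>real_of_int W\<bar> ^ (i - j) * (\<bar>real_of_int (z i)\<bar> * \<bar>real_of_int U\<bar> ^ (N - i)) * \<bar>real_of_int s\<bar> ^ j"
        by (simp add: abs_mult power_abs)
      also have "\<dots> \<le> 2 ^ N * (X ^ 3) ^ (i - j) * (L * (X ^ 3) ^ (N - i)) * (X ^ 3) ^ j"
        using ch W U s z i X L by (intro mult_mono power_mono) auto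
      also have "\<dots> = 2 ^ N * L * ((X ^ 3) ^ (i - j) * (X ^ 3) ^ (N - i) * (X ^ 3) ^ j)" by simp
      also have "(X ^ 3) ^ (i - j) * (X ^ 3) ^ (N - i) * (X ^ 3) ^ j = X ^ (3 * N)"
      proof -
        have "N = i - j + (N - i) + j" using True i by simp
        hence "(X ^ 3) ^ N = (X ^ 3) ^ (i - j) * (X ^ 3) ^ (N - i) * (X ^ 3) ^ j" by (metis power_add)
        thus ?thesis by (simp add: power_mult)
      qed
      finally show ?thesis .
    qed
  qed
  also have "\<dots> = real (N + 1) * 2 ^ N * L * X ^ (3 * N)" by simp
  finally show "\<bar>real_of_int (?g j)\<bar> \<le> real (N + 1) * 2 ^ N * L * X ^ (3 * N)" .
qed

text \<open>Mahler's method: an auxiliary polynomial $P(z, F(z)) \ne 0$ of degree $N$ in both variables that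
  vanishes to order at least $N^2$ at 0 gives, at $z = 1/X$, values of integer polynomials at
  $f(1/b)$ that are too small for Liouville's inequality once $N$ is large compared to the degree.\<close>
lemma not_algebraic_f:
  fixes b :: nat
  assumes "b \<ge> 2"
  shows "\<not> algebraic (f (1 / b))"
proof
  assume "algebraic (f (1 / b))"
  then obtain d :: nat where d: "d > 0"
    "\<And>N. \<exists>c>0. \<forall>H g. H \<ge> 1 \<longrightarrow> (\<forall>i\<le>N. \<bar>real_of_int (g i)\<bar> \<le> H) \<longrightarrow> (\<Sum>i\<le>N. of_int (g i) * f (1 / b) ^ i) \<noteq> 0 \<longrightarrow>
        c \<le> \<bar>\<Sum>i\<le>N. of_int (g i) * f (1 / b) ^ i\<bar> * H ^ (d - 1)"
    by (rule liouville_polynomial) blast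
  \<comment> \<open>The value at f(1/b) is O(X^(4N - (N^2 + 2N))) and its coefficients are
    O(X^(4N)), so Liouville's product has exponent 4N + 4N(d - 1) - N^2 - 2N = 4Nd - N^2 - 2N. For N
    = 4d this is -2N.\<close>
  define N where "N = 4 * d"
  obtain c0 where c0: "c0 > 0" and liouville: "\<And>H g. H \<ge> 1 \<Longrightarrow> (\<And>i. i \<le> N \<Longrightarrow> \<bar>real_of_int (g i)\<bar> \<le> H) \<Longrightarrow>
      (\<Sum>i\<le>N. of_int (g i) * f (1 / b) ^ i) \<noteq> 0 \<Longrightarrow>
        c0 \<le> \<bar>\<Sum>i\<le>N. of_int (g i) * f (1 / b) ^ i\<bar> * H ^ (d - 1)"
    using d(2)[of N] by blast
  obtain P :: "nat \<Rightarrow> int poly" where P: "\<exists>i\<le>N. P i \<noteq> 0" "\<And>i. degree (P i) \<le> N"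
    "\<And>j. j < N\<^sup>2 + 2 * N \<Longrightarrow> fps_nth (\<Sum>i\<le>N. fps_of_poly (P i) * F ^ i) j = 0"
    using auxiliary_polynomial[of N] by metis
  define E where "E = (\<Sum>i\<le>N. fps_of_poly (P i) * F ^ i)"
  have "E \<noteq> 0" using transcendental[of P N] P(1) unfolding E_def by blast
  define G :: "real fps" where "G = fps_of_ints E"
  have G0: "G \<noteq> 0" using \<open>E \<noteq> 0\<close> by (auto simp: G_def fps_eq_iff)
  define M where "M = subdegree G"
  have M: "N\<^sup>2 + 2 * N \<le> M" unfolding M_def
    by (rule subdegree_geI[OF G0]) (use P(3) in \<open>simp add: G_def E_def del: fps_of_ints_sum fps_sum_nth\<close>)
  have rG: "fps_conv_radius G \<ge> 1" unfolding G_def E_def by (rule eval_polynomial_in_F)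
  obtain c C \<delta> where c: "c > 0" "C > 0" "\<delta> > 0"
    "\<And>x. 0 < x \<Longrightarrow> x < \<delta> \<Longrightarrow> c * x ^ M \<le> \<bar>eval_fps G x\<bar> \<and> \<bar>eval_fps G x\<bar> \<le> C * x ^ M"
    using fps_subdegree_bounds[OF rG G0] unfolding M_def by metis
  define L where "L = 1 + (\<Sum>i\<le>N. real_of_int (\<Sum>l\<le>N. \<bar>coeff (P i) l\<bar>))"
  have L: "real_of_int (\<Sum>l\<le>N. \<bar>coeff (P i) l\<bar>) \<le> L" if "i \<le> N" for i
  proof -
    have "real_of_int (\<Sum>l\<le>N. \<bar>coeff (P i) l\<bar>) \<le> (\<Sum>i\<le>N. real_of_int (\<Sum>l\<le>N. \<bar>coeff (P i) l\<bar>))"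
      using that by (intro member_le_sum[of i _ "\<lambda>i. real_of_int (\<Sum>l\<le>N. \<bar>coeff (P i) l\<bar>)"])
        (auto intro: sum_nonneg)
    thus ?thesis by (simp add: L_def)
  qed
  have L1: "L \<ge> 1" unfolding L_def by (simp add: sum_nonneg)
  define D where "D = real (N + 1) * 2 ^ N * L"
  have D1: "D \<ge> 1"
    unfolding D_def using L1 by (intro mult_ge1_I) auto
  \<comment> \<open>The estimates will end in X^(2N) \<le> B, so a single level with X \<ge> B + 1
    is enough for the contradiction.\<close>
  define B where "B = C * D ^ (d - 1) / c0"
  obtain K where K: "\<And>k. k \<ge> K \<Longrightarrow> max (B + 1) (1 / \<delta> + 1) \<le> real b ^ 2 ^ k"
    using eventually_ge_power_tower[OF assms] by metis
  define Y where "Y = int b ^ 2 ^ K"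
  define X where "X = real_of_int Y"
  have X: "B + 1 \<le> X" "1 / \<delta> + 1 \<le> X" using K[of K] by (auto simp: X_def Y_def)
  have "1 / \<delta> > 0" using c(3) by simp
  hence "X > 1" using X(2) by linarith
  hence X1: "X > 1" "Y \<ge> 1" by (simp_all add: X_def)
  have X\<delta>: "0 < 1 / X" "1 / X < \<delta>" "\<bar>1 / X\<bar> < 1"
  proof -
    have "1 / \<delta> < X" using X(2) by linarith
    thus "1 / X < \<delta>" using c(3) X1 by (simp add: field_simps)
  qed (use X1 in auto)
  obtain \<sigma> U W :: int where it: "\<bar>\<sigma>\<bar> = 1" "Y ^ 2 \<le> U" "U \<le> Y ^ 3" "\<bar>W\<bar> \<le> Y ^ 3"
    "of_int U * f (1 / X) = of_int (\<sigma> * Y ^ 2) * f (1 / b) - of_int W"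
    using iterated_equation[OF assms, of K] unfolding X_def Y_def by metis
  have U0: "U > 0" using it(2) X1(2) by (smt (verit) zero_less_power)
  have UX: "\<bar>real_of_int U\<bar> \<le> X ^ 3"
    using it(3) U0 unfolding X_def by (metis abs_of_pos of_int_0_less_iff of_int_le_iff of_int_power)
  have WX: "\<bar>real_of_int W\<bar> \<le> X ^ 3"
    using it(4) unfolding X_def by (metis of_int_abs of_int_le_iff of_int_power)
  have sX: "\<bar>real_of_int (\<sigma> * Y ^ 2)\<bar> \<le> X ^ 3"
  proof -
    have "\<bar>real_of_int (\<sigma> * Y ^ 2)\<bar> = X ^ 2" using it(1) by (simp add: X_def abs_mult flip: of_int_abs)
    also have "\<dots> \<le> X ^ 3" using X1 by (intro power_increasing) auto
    finally show ?thesis .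
  qed
  have "\<forall>i. \<exists>z :: int. real_of_int z = X ^ N * poly (map_poly of_int (P i)) (1 / X) \<and> (i \<le> N \<longrightarrow> \<bar>real_of_int z\<bar> \<le> X ^ N * L)"
  proof
    fix i
    obtain z :: int where z: "real_of_int z = X ^ N * poly (map_poly of_int (P i)) (1 / X)"
        "\<bar>real_of_int z\<bar> \<le> X ^ N * real_of_int (\<Sum>l\<le>N. \<bar>coeff (P i) l\<bar>)"
      using homogenized_value[OF X1(2) P(2)[of i]] unfolding X_def by metis
    have "X ^ N * real_of_int (\<Sum>l\<le>N. \<bar>coeff (P i) l\<bar>) \<le> X ^ N * L" if "i \<le> N"
      using L[OF that] X1 by (intro mult_left_mono) auto
    thus "\<exists>z :: int. real_of_int z = X ^ N * poly (map_poly of_int (P i)) (1 / X) \<and> (i \<le> N \<longrightarrow> \<bar>real_of_int z\<bar> \<le> X ^ N * L)"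
      using z by (intro exI[of _ z]) auto
  qed
  then obtain z :: "nat \<Rightarrow> int" where z: "\<And>i. real_of_int (z i) = X ^ N * poly (map_poly of_int (P i)) (1 / X)"
    "\<And>i. i \<le> N \<Longrightarrow> \<bar>real_of_int (z i)\<bar> \<le> X ^ N * L" by metis
  have XL: "X ^ N * L \<ge> 0" using X1 L1 by simp
  obtain g :: "nat \<Rightarrow> int" where g:
    "\<And>y::real. (\<Sum>i\<le>N. of_int (z i) * of_int U ^ (N - i) * (of_int (\<sigma> * Y ^ 2) * y - of_int W) ^ i) = (\<Sum>j\<le>N. of_int (g j) * y ^ j)"
    "\<And>j. j \<le> N \<Longrightarrow> \<bar>real_of_int (g j)\<bar> \<le> real (N + 1) * 2 ^ N * (X ^ N * L) * X ^ (3 * N)"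
    using bounded_power_combination[where z = z and N = N, OF less_imp_le[OF X1(1)] z(2) XL UX WX sX] by blast
  define \<Lambda> where "\<Lambda> = (\<Sum>j\<le>N. of_int (g j) * f (1 / b) ^ j)"
  have "\<Lambda> = (\<Sum>i\<le>N. of_int (z i) * of_int U ^ (N - i) * (of_int U * f (1 / X)) ^ i)"
    unfolding \<Lambda>_def g(1)[symmetric] it(5) ..
  also have "\<dots> = (\<Sum>i\<le>N. of_int U ^ N * X ^ N * (poly (map_poly of_int (P i)) (1 / X) * f (1 / X) ^ i))"
  proof (rule sum.cong[OF refl])
    fix i assume "i \<in> {..N}"
    hence "(of_int U :: real) ^ N = of_int U ^ (N - i) * of_int U ^ i" by (simp flip: power_add)
    thus "of_int (z i) * of_int U ^ (N - i) * (of_int U * f (1 / X)) ^ i =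
        of_int U ^ N * X ^ N * (poly (map_poly of_int (P i)) (1 / X) * f (1 / X) ^ i)"
      by (simp add: z(1) power_mult_distrib)
  qed
  also have "\<dots> = of_int U ^ N * X ^ N * eval_fps G (1 / X)"
    unfolding G_def E_def eval_polynomial_in_F(2)[OF X\<delta>(3)] by (simp add: sum_distrib_left)
  finally have \<Lambda>: "\<bar>\<Lambda>\<bar> = \<bar>of_int U\<bar> ^ N * X ^ N * \<bar>eval_fps G (1 / X)\<bar>"
    using X1 by (simp add: abs_mult power_abs)
  have G1: "c * (1 / X) ^ M \<le> \<bar>eval_fps G (1 / X)\<bar>" "\<bar>eval_fps G (1 / X)\<bar> \<le> C * (1 / X) ^ M"
    using c(4)[OF X\<delta>(1,2)] by auto
  \<comment> \<open>Non-vanishing, without which Liouville's inequality is void, comes from the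
    lowest coefficient of G at a point close enough to 0.\<close>
  have "c * (1 / X) ^ M > 0" using c(1) X1 by simp
  hence "\<Lambda> \<noteq> 0" using \<Lambda> G1(1) U0 X1 by auto
  have gD: "\<bar>real_of_int (g j)\<bar> \<le> D * X ^ (4 * N)" if "j \<le> N" for j
  proof -
    have "4 * N = N + 3 * N" by simp
    hence "X ^ (4 * N) = X ^ N * X ^ (3 * N)" by (simp only: power_add)
    thus ?thesis using g(2)[OF that] by (simp add: D_def mult_ac)
  qed
  have "1 * 1 \<le> D * X ^ (4 * N)" using D1 X1 by (intro mult_mono) auto
  hence "c0 \<le> \<bar>\<Lambda>\<bar> * (D * X ^ (4 * N)) ^ (d - 1)"
    using liouville[of "D * X ^ (4 * N)" g] gD \<open>\<Lambda> \<noteq> 0\<close> unfolding \<Lambda>_def by simp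
  also have "\<dots> \<le> ((X ^ 3) ^ N * X ^ N * (C * (1 / X) ^ (N\<^sup>2 + 2 * N))) * (D * X ^ (4 * N)) ^ (d - 1)"
  proof (intro mult_right_mono)
    have "(1 / X) ^ M \<le> (1 / X) ^ (N\<^sup>2 + 2 * N)" using X1 M by (intro power_decreasing) auto
    hence "\<bar>eval_fps G (1 / X)\<bar> \<le> C * (1 / X) ^ (N\<^sup>2 + 2 * N)"
      using G1(2) c(2) by (meson mult_left_mono order_trans less_imp_le)
    thus "\<bar>\<Lambda>\<bar> \<le> (X ^ 3) ^ N * X ^ N * (C * (1 / X) ^ (N\<^sup>2 + 2 * N))"
      unfolding \<Lambda> using UX X1 by (intro mult_mono power_mono) auto
    show "0 \<le> (D * X ^ (4 * N)) ^ (d - 1)" using D1 X1 by simp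
  qed
  also have "\<dots> = C * D ^ (d - 1) * (X ^ (3 * N + N + 4 * N * (d - 1)) * (1 / X) ^ (N\<^sup>2 + 2 * N))"
  proof -
    have "(X ^ 3) ^ N = X ^ (3 * N)" "(D * X ^ (4 * N)) ^ (d - 1) = D ^ (d - 1) * X ^ (4 * N * (d - 1))"
      by (simp_all only: power_mult power_mult_distrib)
    thus ?thesis by (simp only: power_add mult_ac)
  qed
  also have "3 * N + N + 4 * N * (d - 1) = N\<^sup>2"
    using d(1) by (cases d) (simp_all add: N_def power2_eq_square algebra_simps)
  also have "X ^ N\<^sup>2 * (1 / X) ^ (N\<^sup>2 + 2 * N) = (1 / X) ^ (2 * N)"
    using X1 by (simp add: power_add power_divide)
  finally have "c0 \<le> C * D ^ (d - 1) * (1 / X) ^ (2 * N)" .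
  hence "c0 * X ^ (2 * N) \<le> C * D ^ (d - 1)"
    using X1 by (simp add: power_divide field_simps)
  hence "X ^ (2 * N) \<le> B" using c0 by (simp add: B_def field_simps)
  moreover have "X \<le> X ^ (2 * N)" using X1 d(1) by (intro self_le_power) (auto simp: N_def)
  ultimately show False using X(1) by linarith
qed

end

text \<open>The index shift exchanges the parities: even coefficients of the series use the odd rule
  and conversely. The coefficient at 0 is the initial value 1, outside the recurrence, and the
  constant 2t corrects it because 2t + (1 - 2t) = 1.\<close>

lemma stern_seriesI:
  assumes "t = 0 \<or> t = 1" "a 1 = 1" "\<And>n. n \<ge> 1 \<Longrightarrow> a (2 * n) = (1 - 2 * t) * a n"
    "\<And>n. n \<ge> 1 \<Longrightarrow> a (2 * n + 1) = (1 - 2 * t) * (a n + a (n + 1))"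
  shows "stern_series t (Abs_fps (\<lambda>n. a (n + 1)))"
proof
  let ?F = "Abs_fps (\<lambda>n. a (n + 1))"
  show "t = 0 \<or> t = 1" "fps_nth ?F 0 = 1" using assms(1,2) by simp_all
  define H where "H = ?F oo fps_X\<^sup>2"
  have H: "fps_nth H n = (if even n then a (n div 2 + 1) else 0)" for n
    by (simp add: H_def fps_nth_compose_X_power)
  have "?F = fps_const (2 * t) + fps_const (1 - 2 * t) * (H + fps_X * H + fps_X * (fps_X * H))"
  proof (rule fps_ext)
    fix n
    consider "n = 0" | m where "n = 2 * Suc m" | m where "n = 2 * m + 1"
      by (metis evenE not0_implies_Suc mult_0_right oddE)
    thus "fps_nth ?F n = fps_nth (fps_const (2 * t) + fps_const (1 - 2 * t) * (H + fps_X * H + fps_X * (fps_X * H))) n"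
    proof cases
      case 1
      thus ?thesis using assms(2) by (simp add: H)
    next
      case (2 m)
      show ?thesis using assms(4)[of "Suc m"] unfolding 2 by (simp add: H add.commute)
    next
      case (3 m)
      show ?thesis using assms(3)[of "Suc m"] unfolding 3 by (simp add: H)
    qed
  qed
  thus "?F = fps_const (2 * t) + fps_const (1 - 2 * t) * (1 + fps_X + fps_X\<^sup>2) * (?F oo fps_X\<^sup>2)"
    unfolding H_def[symmetric] by (simp add: algebra_simps power2_eq_square)
qed

theorem theorem2p4:
  fixes b :: nat
  assumes "b \<ge> 2"
  shows "\<not> algebraic (stern_S (1 / real b)) \<and> \<not> algebraic (stern_T (1 / real b)) \<and>
         irrationality_exponent (stern_S (1 / real b)) = 2 \<and>
         irrationality_exponent (stern_T (1 / real b)) = 2"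
proof -
  have S: "stern 1 = 1" "n \<ge> 1 \<Longrightarrow> stern (2 * n) = stern n"
    "n \<ge> 1 \<Longrightarrow> stern (2 * n + 1) = stern n + stern (n + 1)" for n
    by (subst stern.simps; simp)+
  have T: "twisted_stern 1 = 1" "n \<ge> 1 \<Longrightarrow> twisted_stern (2 * n) = - twisted_stern n"
    "n \<ge> 1 \<Longrightarrow> twisted_stern (2 * n + 1) = - (twisted_stern n + twisted_stern (n + 1))" for n
    by (subst twisted_stern.simps; simp)+
  interpret S: stern_series 0 "Abs_fps (\<lambda>n. stern (n + 1))"
    by (rule stern_seriesI) (use S in \<open>simp_all del: stern.simps\<close>)
  interpret T: stern_series 1 "Abs_fps (\<lambda>n. twisted_stern (n + 1))"
    by (rule stern_seriesI) (use T in \<open>simp_all del: twisted_stern.simps\<close>)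
  have "stern_S z = S.f z" "stern_T z = T.f z" for z
    unfolding stern_S_def stern_T_def S.f_def T.f_def eval_fps_def
    by (simp_all del: stern.simps twisted_stern.simps)
  thus ?thesis
    using S.not_algebraic_f[OF assms] T.not_algebraic_f[OF assms]
      S.irrationality_exponent_f[OF assms] T.irrationality_exponent_f[OF assms] by simp
qed

end
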